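(* Let $D$ be a weighted oriented graph (in which, by convention, every source has weight $1$), let $G$ be its underlying graph, and let $I(D)\subset S=K[t_1,\ldots,t_s]$ be its edge ideal. Then $I(D)^n=I(D)^{(n)}$ for all $n\geq 1$ if and only if the following two conditions hold: (a) every vertex in $V^+(D)$ is a sink; (b) $G$ is a bipartite graph.
   Context: Let $G$ be a finite simple graph with vertex set $\{t_1,\ldots,t_s\}$ and edge set $E(G)$. A weighted oriented graph $D$ with underlying graph $G$ is a triple $(V(D),E(D),w)$ where $V(D)=V(G)$, $E(D)\subset V(D)\times V(D)$ satisfies $E(G)=\{\{t_i,t_j\}\mid (t_i,t_j)\in E(D)\}$ and $|E(D)|=|E(G)|$ (so each edge of $G$ receives exactly one direction), and $w\colon V(D)\to\{1,2,3,\ldots\}$ is a weight function; write $w_i=w(t_i)$. The edge $(t_i,t_j)$ is directed from $t_i$ to $t_j$. A source is a vertex with only outgoing edges; a sink is a vertex with only incoming edges. Standing convention: every source of $D$ has weight $1$. Set $V^+(D)=\{t_i\in V(D)\mid w_i>1\}$. Let $K$ be a field and $S=K[t_1,\ldots,t_s]$, with the vertices regarded as variables. The edge ideal of $D$ is $I(D)=(\{t_it_j^{w_j}\mid (t_i,t_j)\in E(D)\})\subset S$. For $n\ge 1$, the $n$-th symbolic power of an ideal $I$ of $S$ is defined using the minimal primes: if $\mathfrak p_1,\ldots,\mathfrak p_r$ are the minimal primes of $I$, then $I^{(n)}=\bigcap_{i=1}^r (I^nS_{\mathfrak p_i}\cap S)$. *)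

theory Defs
  imports
    "HOL-Library.Poly_Mapping"
    "HOL-Algebra.Ideal_Product"
    "HOL-Algebra.Algebraic_Closure_Type"
    "HOL-Computational_Algebra.Normalized_Fraction"
begin

section \<open>Weighted oriented graphs\<close>

text \<open>
  The vertex set is the whole type \<open>'v\<close>, which is finite. A simple graph on it is given by its
  set of edges, the edges being two-element sets of vertices.
\<close>

definition simple_graph :: "'v set set \<Rightarrow> bool" where
  "simple_graph EG \<longleftrightarrow> (\<forall>e\<in>EG. card e = 2)"

definition bipartite :: "'v set set \<Rightarrow> bool" where
  "bipartite EG \<longleftrightarrow>
     (\<exists>A B. A \<union> B = UNIV \<and> A \<inter> B = {} \<and> (\<forall>e\<in>EG. \<exists>x\<in>A. \<exists>y\<in>B. e = {x, y}))"

locale weighted_oriented_graph =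
  fixes EG :: "'v::finite set set"
    and ED :: "('v \<times> 'v) set"
    and w :: "'v \<Rightarrow> nat"
  assumes simple: "simple_graph EG"
    and underlying: "EG = {{x, y} |x y. (x, y) \<in> ED}"
    and one_direction: "card ED = card EG"
    and weight_pos: "\<And>x. w x \<ge> 1"

text \<open>
  An isolated vertex has, vacuously, only outgoing edges and only incoming edges, so it counts
  both as a source and as a sink.
\<close>

definition is_source :: "('v \<times> 'v) set \<Rightarrow> 'v \<Rightarrow> bool" where
  "is_source ED v \<longleftrightarrow> (\<forall>x. (x, v) \<notin> ED)"

definition is_sink :: "('v \<times> 'v) set \<Rightarrow> 'v \<Rightarrow> bool" where
  "is_sink ED v \<longleftrightarrow> (\<forall>y. (v, y) \<notin> ED)"

definition V_plus :: "('v \<Rightarrow> nat) \<Rightarrow> 'v set" where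
  "V_plus w = {x. w x > 1}"


section \<open>Symbolic powers\<close>

text \<open>
  Ideals and prime ideals are those of \<^theory>\<open>HOL-Algebra.Ideal\<close>, taken in the ring
  \<^const>\<open>ring_of_type_algebra\<close> formed by a whole type; powers of ideals are powers for the
  product of ideals, the multiplication of \<^const>\<open>ideals_set\<close>.
\<close>

definition ideal_power :: "'a::comm_ring_1 set \<Rightarrow> nat \<Rightarrow> 'a set" where
  "ideal_power I n = I [^]\<^bsub>ideals_set ring_of_type_algebra\<^esub> n"

definition minimal_primes :: "'a::comm_ring_1 set \<Rightarrow> 'a set set" where
  "minimal_primes I =
     {p. primeideal p ring_of_type_algebra \<and> I \<subseteq> p \<and>
         (\<forall>q. primeideal q ring_of_type_algebra \<and> I \<subseteq> q \<and> q \<subseteq> p \<longrightarrow> q = p)}"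

text \<open>
  The localization of a domain at a prime ideal \<open>p\<close>, as a subring of its field of fractions.
  Since \<open>0 \<in> p\<close>, the denominators are nonzero.
\<close>

definition localization :: "'a::idom set \<Rightarrow> 'a fract ring" where
  "localization p = ring_of_type_algebra \<lparr>carrier := {Fract a b |a b. b \<notin> p}\<rparr>"

definition extended_ideal :: "'a::idom set \<Rightarrow> 'a set \<Rightarrow> 'a fract set" where
  "extended_ideal p I = Idl\<^bsub>localization p\<^esub> (to_fract ` I)"

definition contracted_ideal :: "'a::idom fract set \<Rightarrow> 'a set" where
  "contracted_ideal J = to_fract -` J"

definition symbolic_power :: "'a::idom set \<Rightarrow> nat \<Rightarrow> 'a set" where
  "symbolic_power I n =
     (\<Inter>p\<in>minimal_primes I. contracted_ideal (extended_ideal p (ideal_power I n)))"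


section \<open>The edge ideal\<close>

text \<open>
  The polynomial ring over \<open>'k\<close> with variables \<open>'v\<close>: finitely supported maps from exponent
  vectors to coefficients, with the convolution product. A linear order on the variables is needed
  only because the library's proof that this ring is a domain is restricted to ordered exponents.
\<close>

type_synonym ('v, 'k) mpoly = "('v \<Rightarrow>\<^sub>0 nat) \<Rightarrow>\<^sub>0 'k"

definition Var :: "'v \<Rightarrow> ('v, 'k::field) mpoly" where
  "Var x = Poly_Mapping.single (Poly_Mapping.single x 1) 1"

definition edge_ideal :: "('v \<times> 'v) set \<Rightarrow> ('v \<Rightarrow> nat) \<Rightarrow> ('v, 'k::field) mpoly set" where
  "edge_ideal ED w = Idl\<^bsub>ring_of_type_algebra\<^esub> {Var x * Var y ^ w y |x y. (x, y) \<in> ED}"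

end

theory Submission
  imports Defs
begin

text \<open>
  Write \<open>I\<close> for the edge ideal, \<open>t\<^sub>v\<close> for the variable of a vertex \<open>v\<close>, and \<open>p\<^sub>C\<close> for the ideal generated by
  the variables of a set \<open>C\<close> of vertices. The whole argument takes place on exponent vectors. Powers
  of \<open>I\<close> are monomial ideals: \<open>f\<close> lies in the \<open>n\<close>-th power iff each exponent vector of \<open>f\<close> dominates
  a sum of \<open>n\<close> exponent vectors of generators (\<open>mem_edge_ideal_power_iff\<close>). The minimal primes of \<open>I\<close>
  are the \<open>p\<^sub>C\<close> for the minimal vertex covers \<open>C\<close> (\<open>minimal_primes_edge_ideal\<close>). So \<open>f\<close> lies in the
  \<open>n\<close>-th symbolic power iff for each such \<open>C\<close> there is some \<open>h\<close> outside \<open>p\<^sub>C\<close> with \<open>h * f\<close> in the \<open>n\<close>-th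
  power.

  Locally at \<open>p\<^sub>C\<close> the power \<open>t\<^sub>v ^ w v\<close> belongs to \<open>I\<close> for every \<open>v\<close> in \<open>C\<close>: by minimality \<open>v\<close> has a
  neighbour outside \<open>C\<close>, whose variable has become a unit. This puts many monomials into symbolic
  powers. First, let \<open>y\<close> be a vertex of weight at least 2 that is not a sink. As it is not a source
  either, there are edges \<open>(x, y)\<close> and \<open>(y, z)\<close>, and the product of \<open>t\<^sub>x\<close>, \<open>t\<^sub>y ^ w y\<close> and
  \<open>t\<^sub>z ^ w z\<close> lies in the second symbolic power (\<open>path_in_symbolic_square\<close>) but is not divisible by two
  generators (\<open>path_not_edge_multiple\<close>). Secondly, suppose that all vertices of weight greater than 1
  are sinks, so that tails of edges have weight 1. If \<open>t\<^sub>v\<close> is given degree \<open>1 / w v\<close>, each generator has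
  degree 2. In a graph that is not bipartite take a closed walk of length \<open>2 * k + 1\<close> which visits
  \<open>v\<close> exactly \<open>b v\<close> times. A vertex cover meets at least \<open>k + 1\<close> of the positions of the walk, so that the
  product of all \<open>t\<^sub>v ^ (w v * b v)\<close> lies in the symbolic power of exponent \<open>k + 1\<close>; but its degree
  \<open>2 * k + 1\<close> is too small for a product of \<open>k + 1\<close> generators
  (\<open>symbolic_not_ordinary_if_odd_weights\<close>).

  Conversely, let tails have weight 1 and the graph be bipartite. For a vertex cover \<open>C\<close>, each
  generator contributes at least 1 to the sum over \<open>c \<in> C\<close> of the integer parts of \<open>a\<^sub>c / w c\<close>, where \<open>a\<close>
  is an exponent vector. This sum ignores the variables outside \<open>C\<close>, so passing to the local ring at
  \<open>p\<^sub>C\<close> preserves the bound (\<open>keys_saturated\<close>): the exponent vectors \<open>a\<close> of an element of the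
  symbolic power of exponent \<open>n\<close> satisfy it with value at least \<open>n\<close>, for every cover. With
  \<open>a\<^sub>c div w c\<close> as the capacity of \<open>c\<close>, every cover then has capacity at least \<open>n\<close>, and by the theorem of
  Koenig for bipartite graphs with vertex capacities one can choose \<open>n\<close> edges, with repetitions,
  within these capacities (\<open>bipartite_reducing_edge\<close>, \<open>edge_multiple_if_covers\<close>). The product of
  their generators divides the monomial of \<open>a\<close>.
\<close>

section \<open>Ideals of a commutative ring type and their powers\<close>

abbreviation is_ideal :: "'a::comm_ring_1 set \<Rightarrow> bool" where
  "is_ideal I \<equiv> ideal I ring_of_type_algebra"

lemma a_inv_of_type: "\<ominus>\<^bsub>ring_of_type_algebra\<^esub> a = - (a :: 'a::comm_ring_1)"
proof -
  interpret cring "ring_of_type_algebra :: 'a ring" ..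
  have "(- a) \<oplus>\<^bsub>ring_of_type_algebra\<^esub> a = \<zero>\<^bsub>ring_of_type_algebra\<^esub>"
    by (simp add: ring_of_type_algebra_def)
  then show ?thesis
    by (intro minus_equality) (auto simp: ring_of_type_algebra_def)
qed

text \<open>
  Ideals are needed in two kinds of rings, a full type and a localization inside the field of
  fractions. Both are subrings of a full type, so a single criterion serves for both.
\<close>

lemma ideal_subring_iff:
  fixes I H :: "'a::comm_ring_1 set"
  assumes "subring H ring_of_type_algebra"
  shows "ideal I (ring_of_type_algebra\<lparr>carrier := H\<rparr>) \<longleftrightarrow>
     I \<subseteq> H \<and> 0 \<in> I \<and> (\<forall>a\<in>I. \<forall>b\<in>I. a + b \<in> I) \<and> (\<forall>a\<in>I. \<forall>r\<in>H. r * a \<in> I)"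
    (is "ideal I ?H \<longleftrightarrow> ?R")
proof -
  interpret R: cring "ring_of_type_algebra :: 'a ring" ..
  interpret H: ring ?H by (rule R.subring_is_ring) fact
  have H1: "- 1 \<in> H"
    using subringE(3)[OF assms] subringE(5)[OF assms, of 1]
    by (simp add: a_inv_of_type) (simp add: ring_of_type_algebra_def)
  show ?thesis
  proof
    assume "ideal I ?H"
    then interpret ideal I ?H .
    show ?R
      using zero_closed a_closed I_l_closed a_subset by (auto simp: ring_of_type_algebra_def)
  next
    assume R: ?R
    have neg: "- a \<in> I" if "a \<in> I" for a
      using R that H1 by (metis mult_minus1)
    have "\<ominus>\<^bsub>?H\<^esub> a = - a" if "a \<in> I" for a
      using R neg that by (intro H.minus_equality) (auto simp: ring_of_type_algebra_def)
    then have inv: "inv\<^bsub>add_monoid ?H\<^esub> a = - a" if "a \<in> I" for a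
      using that by (simp add: a_inv_def)
    show "ideal I ?H"
    proof (intro idealI H.ring_axioms subgroup.intro)
      show "inv\<^bsub>add_monoid ?H\<^esub> x \<in> I" if "x \<in> I" for x
        using inv[OF that] neg[OF that] by simp
    qed (use R in \<open>auto simp: ring_of_type_algebra_def mult.commute\<close>)
  qed
qed

lemma ideal_of_type_iff:
  "ideal I (ring_of_type_algebra :: 'a::comm_ring_1 ring) \<longleftrightarrow>
     0 \<in> I \<and> (\<forall>a\<in>I. \<forall>b\<in>I. a + b \<in> I) \<and> (\<forall>a\<in>I. \<forall>r. r * a \<in> I)"
proof -
  interpret cring "ring_of_type_algebra :: 'a ring" ..
  have U: "carrier (ring_of_type_algebra :: 'a ring) = UNIV"
    by (simp add: ring_of_type_algebra_def)
  have "ring_of_type_algebra\<lparr>carrier := UNIV\<rparr> = (ring_of_type_algebra :: 'a ring)"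
    by (simp add: ring_of_type_algebra_def)
  moreover have "subring UNIV (ring_of_type_algebra :: 'a ring)"
    by (rule subringI) (auto simp: U)
  ultimately show ?thesis
    using ideal_subring_iff[of UNIV I] by simp
qed

lemma primeideal_of_type_iff:
  "primeideal I (ring_of_type_algebra :: 'a::comm_ring_1 ring) \<longleftrightarrow>
     is_ideal I \<and> 1 \<notin> I \<and> (\<forall>a b. a * b \<in> I \<longrightarrow> a \<in> I \<or> b \<in> I)"
    (is "_ \<longleftrightarrow> ?R")
proof
  assume "primeideal I (ring_of_type_algebra :: 'a ring)"
  then interpret primeideal I "ring_of_type_algebra :: 'a ring" .
  have "1 \<notin> I"
    using one_imp_carrier I_notcarr by (auto simp: ring_of_type_algebra_def)
  then show ?R
    using I_prime ideal_axioms by (auto simp: ring_of_type_algebra_def)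
next
  assume ?R
  then show "primeideal I (ring_of_type_algebra :: 'a ring)"
    by (intro primeidealI cring_from_type_algebra) (auto simp: ring_of_type_algebra_def)
qed

lemma ideal_sum:
  assumes "is_ideal I" "\<And>i. i \<in> A \<Longrightarrow> f i \<in> I"
  shows "sum f A \<in> I"
  using assms by (induction A rule: infinite_finite_induct) (auto simp: ideal_of_type_iff)

lemma generated_is_ideal: "is_ideal (Idl\<^bsub>ring_of_type_algebra\<^esub> (A :: 'a::comm_ring_1 set))"
  by (intro ring.genideal_ideal ring_from_type_algebra) (simp add: ring_of_type_algebra_def)

lemma generated_least:
  fixes J :: "'a::comm_ring_1 set"
  assumes "is_ideal J" "A \<subseteq> J"
  shows "Idl\<^bsub>ring_of_type_algebra\<^esub> A \<subseteq> J"
  using assms by (intro ring.genideal_minimal ring_from_type_algebra)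

lemma generators_in_generated: "A \<subseteq> Idl\<^bsub>ring_of_type_algebra\<^esub> (A :: 'a::comm_ring_1 set)"
  by (intro ring.genideal_self ring_from_type_algebra) (simp add: ring_of_type_algebra_def)

lemma ideal_power_0: "ideal_power (I :: 'a::comm_ring_1 set) 0 = UNIV"
  by (simp add: ideal_power_def nat_pow_def ideals_set_def ring_of_type_algebra_def)

lemma ideal_power_Suc:
  "ideal_power (I :: 'a::comm_ring_1 set) (Suc n) = ideal_power I n \<cdot>\<^bsub>ring_of_type_algebra\<^esub> I"
  by (simp add: ideal_power_def nat_pow_def ideals_set_def)

lemma ideal_power_is_ideal:
  assumes "is_ideal I"
  shows "is_ideal (ideal_power I n)"
proof (induction n)
  case 0
  then show ?case by (simp add: ideal_power_0 ideal_of_type_iff)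
next
  case (Suc n)
  then show ?case
    unfolding ideal_power_Suc by (intro ring.ideal_prod_is_ideal assms ring_from_type_algebra)
qed

lemma ideal_power_1:
  assumes "is_ideal I"
  shows "ideal_power I (Suc 0) = I"
proof -
  interpret cring "ring_of_type_algebra :: 'a ring" by (rule cring_from_type_algebra)
  have U: "carrier (ring_of_type_algebra :: 'a ring) = UNIV"
    by (simp add: ring_of_type_algebra_def)
  show ?thesis
    using ideal_prod_one[OF assms] ideal_prod_commute[OF assms oneideal]
    by (simp add: ideal_power_Suc ideal_power_0 U)
qed

lemma ideal_power_mult_generator:
  "a \<in> ideal_power I n \<Longrightarrow> b \<in> I \<Longrightarrow> a * b \<in> ideal_power I (Suc n)"
  unfolding ideal_power_Suc
  using ideal_prod.prod[of a "ideal_power I n" b I ring_of_type_algebra]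
  by (simp add: ring_of_type_algebra_def)

lemma ideal_power_Suc_induct [consumes 1, case_names mult add]:
  assumes "x \<in> ideal_power I (Suc n)"
    and "\<And>a b. a \<in> ideal_power I n \<Longrightarrow> b \<in> I \<Longrightarrow> P (a * b)"
    and "\<And>x y. P x \<Longrightarrow> P y \<Longrightarrow> P (x + y)"
  shows "P x"
  using assms(1) unfolding ideal_power_Suc
proof (induction rule: ideal_prod.induct)
  case (prod i j)
  then show ?case using assms(2) by (simp add: ring_of_type_algebra_def)
next
  case (sum s1 s2)
  then show ?case using assms(3) by (simp add: ring_of_type_algebra_def)
qed

lemma ideal_power_mult:
  assumes "is_ideal I" "a \<in> ideal_power I m" "b \<in> ideal_power I n"
  shows "a * b \<in> ideal_power I (m + n)"
  using assms(3)
proof (induction n arbitrary: b)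
  case 0
  then show ?case
    using assms ideal_power_is_ideal[OF assms(1), of m] by (simp add: ideal_of_type_iff mult.commute)
next
  case (Suc n)
  from Suc.prems show ?case
  proof (induction rule: ideal_power_Suc_induct)
    case (mult c d)
    then have "(a * c) * d \<in> ideal_power I (Suc (m + n))"
      by (intro ideal_power_mult_generator Suc.IH)
    then show ?case by (simp add: mult.assoc)
  next
    case (add x y)
    then show ?case
      using ideal_power_is_ideal[OF assms(1), of "m + Suc n"]
      by (simp add: ideal_of_type_iff distrib_left)
  qed
qed

section \<open>Symbolic powers through denominators\<close>

lemma subring_local_fractions:
  fixes p :: "'a::idom set"
  assumes "primeideal p ring_of_type_algebra"
  shows "subring {Fract a b |a b. b \<notin> p} ring_of_type_algebra"
proof -
  interpret ring "ring_of_type_algebra :: 'a fract ring" ..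
  have p: "0 \<in> p" "1 \<notin> p" "\<And>a b. a * b \<in> p \<Longrightarrow> a \<in> p \<or> b \<in> p"
    using assms by (auto simp: primeideal_of_type_iff ideal_of_type_iff)
  have nz: "b \<noteq> 0" if "b \<notin> p" for b
    using that p by auto
  show ?thesis
  proof (rule subringI)
    show "\<one>\<^bsub>ring_of_type_algebra\<^esub> \<in> {Fract a b |a b. b \<notin> p}"
      using p by (auto simp: ring_of_type_algebra_def One_fract_def)
    show "\<ominus>\<^bsub>ring_of_type_algebra\<^esub> x \<in> {Fract a b |a b. b \<notin> p}"
      if x: "x \<in> {Fract a b |a b. b \<notin> p}" for x
    proof -
      obtain a b where "x = Fract a b" "b \<notin> p" using x by blast
      then have "\<ominus>\<^bsub>ring_of_type_algebra\<^esub> x = Fract (- a) b" by (simp add: a_inv_of_type)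
      with \<open>b \<notin> p\<close> show ?thesis by blast
    qed
    fix x y assume "x \<in> {Fract a b |a b. b \<notin> p}" "y \<in> {Fract a b |a b. b \<notin> p}"
    then obtain a b c d where x: "x = Fract a b" "b \<notin> p" and y: "y = Fract c d" "d \<notin> p"
      by blast
    have bd: "b * d \<notin> p" using p x y by blast
    have "x * y = Fract (a * c) (b * d)" "x + y = Fract (a * d + c * b) (b * d)"
      using x y nz by auto
    then show "x \<otimes>\<^bsub>ring_of_type_algebra\<^esub> y \<in> {Fract a b |a b. b \<notin> p}"
      "x \<oplus>\<^bsub>ring_of_type_algebra\<^esub> y \<in> {Fract a b |a b. b \<notin> p}"
      using bd by (auto simp: ring_of_type_algebra_def)
  qed (auto simp: ring_of_type_algebra_def)
qed

text \<open>
  The fractions with numerator in \<open>I\<close> and denominator outside \<open>p\<close> form an ideal of the localization,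
  hence they exhaust the extension of \<open>I\<close>; and \<open>f = a / h\<close> means \<open>h * f = a\<close>.
\<close>

lemma mem_contracted_extended_ideal_iff:
  fixes I p :: "'a::idom set"
  assumes p: "primeideal p ring_of_type_algebra" and I: "is_ideal I"
  shows "f \<in> contracted_ideal (extended_ideal p I) \<longleftrightarrow> (\<exists>h. h \<notin> p \<and> h * f \<in> I)"
proof
  define L where "L = {Fract a b |a b. b \<notin> p}"
  have loc: "localization p = ring_of_type_algebra\<lparr>carrier := L\<rparr>"
    by (simp add: localization_def L_def)
  have sub: "subring L ring_of_type_algebra"
    unfolding L_def by (rule subring_local_fractions[OF p])
  have P: "0 \<in> p" "1 \<notin> p" "\<And>a b. a * b \<in> p \<Longrightarrow> a \<in> p \<or> b \<in> p"
    using p by (auto simp: primeideal_of_type_iff ideal_of_type_iff)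
  have nz: "b \<noteq> 0" if "b \<notin> p" for b
    using that P by auto
  have I': "0 \<in> I" "\<And>a b. a \<in> I \<Longrightarrow> b \<in> I \<Longrightarrow> a + b \<in> I" "\<And>r a. a \<in> I \<Longrightarrow> r * a \<in> I"
    using I by (auto simp: ideal_of_type_iff)
  show "f \<in> contracted_ideal (extended_ideal p I)" if "\<exists>h. h \<notin> p \<and> h * f \<in> I"
  proof -
    obtain h where h: "h \<notin> p" "h * f \<in> I" using \<open>\<exists>h. _\<close> by blast
    have "to_fract f \<in> J" if J: "ideal J (localization p)" "to_fract ` I \<subseteq> J" for J
    proof -
      have "Fract 1 h \<in> L" unfolding L_def using h by blast
      moreover have "to_fract (h * f) \<in> J" using J h by blast
      ultimately have "Fract 1 h * to_fract (h * f) \<in> J"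
        using J(1) unfolding loc ideal_subring_iff[OF sub] by blast
      moreover have "Fract 1 h * to_fract (h * f) = to_fract f"
        using nz[OF h(1)] by (simp add: to_fract_def eq_fract)
      ultimately show ?thesis by (simp only:)
    qed
    then show ?thesis
      by (auto simp: contracted_ideal_def extended_ideal_def genideal_def)
  qed
  show "\<exists>h. h \<notin> p \<and> h * f \<in> I" if f: "f \<in> contracted_ideal (extended_ideal p I)"
  proof -
    define J where "J = {Fract a b |a b. a \<in> I \<and> b \<notin> p}"
    have "ideal J (localization p)"
      unfolding loc ideal_subring_iff[OF sub]
    proof (intro conjI ballI)
      show "J \<subseteq> L" by (auto simp: J_def L_def)
      show "0 \<in> J" using I' P by (auto simp: J_def Zero_fract_def)
    next
      fix x y assume "x \<in> J" "y \<in> J"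
      then obtain a b c d where x: "x = Fract a b" "a \<in> I" "b \<notin> p"
        and y: "y = Fract c d" "c \<in> I" "d \<notin> p"
        by (auto simp: J_def)
      have "x + y = Fract (d * a + b * c) (b * d)" using x y nz by (simp add: mult.commute)
      moreover have "b * d \<notin> p" "d * a + b * c \<in> I" using x y P I' by blast+
      ultimately show "x + y \<in> J" by (auto simp: J_def)
    next
      fix x y assume "x \<in> J" "y \<in> L"
      then obtain a b c d where x: "x = Fract a b" "a \<in> I" "b \<notin> p"
        and y: "y = Fract c d" "d \<notin> p"
        by (auto simp: J_def L_def)
      have "y * x = Fract (c * a) (d * b)" using x y by simp
      moreover have "d * b \<notin> p" "c * a \<in> I" using x y P I' by blast+
      ultimately show "y * x \<in> J" by (auto simp: J_def)
    qed
    moreover have "to_fract ` I \<subseteq> J"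
      using P by (auto simp: J_def to_fract_def)
    ultimately have "to_fract f \<in> J"
      using f by (auto simp: contracted_ideal_def extended_ideal_def genideal_def)
    then obtain a b where ab: "Fract f 1 = Fract a b" "a \<in> I" "b \<notin> p"
      by (auto simp: J_def to_fract_def)
    then have "b * f = a" using nz[OF ab(3)] by (simp add: eq_fract mult.commute)
    with ab show ?thesis by blast
  qed
qed

lemma mem_symbolic_power_iff:
  assumes "is_ideal (I :: 'a::idom set)"
  shows "f \<in> symbolic_power I n \<longleftrightarrow>
     (\<forall>p\<in>minimal_primes I. \<exists>h. h \<notin> p \<and> h * f \<in> ideal_power I n)"
  using mem_contracted_extended_ideal_iff[OF _ ideal_power_is_ideal[OF assms]]
  by (auto simp: symbolic_power_def minimal_primes_def)

text \<open>
  Denominators multiply, and their product avoids \<open>p\<close> because \<open>p\<close> is prime.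
\<close>

lemma locally_in_ideal_power_mult:
  assumes I: "is_ideal I" and p: "primeideal p ring_of_type_algebra"
    and f: "\<exists>h. h \<notin> p \<and> h * f \<in> ideal_power I m"
    and g: "\<exists>h. h \<notin> p \<and> h * g \<in> ideal_power I n"
  shows "\<exists>h. h \<notin> p \<and> h * (f * g) \<in> ideal_power I (m + n)"
proof -
  obtain h h' where "h \<notin> p" "h * f \<in> ideal_power I m" "h' \<notin> p" "h' * g \<in> ideal_power I n"
    using f g by blast
  then have "h * h' \<notin> p" "(h * f) * (h' * g) \<in> ideal_power I (m + n)"
    using p ideal_power_mult[OF I] by (auto simp: primeideal_of_type_iff)
  then show ?thesis by (auto simp: mult_ac intro!: exI[of _ "h * h'"])
qed

section \<open>Monomial ideals\<close>

abbreviation "keys \<equiv> Poly_Mapping.keys"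
abbreviation "lookup \<equiv> Poly_Mapping.lookup"
abbreviation "single \<equiv> Poly_Mapping.single"

lemma monomial_ideal:
  assumes "\<And>a b. P a \<Longrightarrow> P (a + b)"
  shows "is_ideal {f :: ('v \<Rightarrow>\<^sub>0 nat) \<Rightarrow>\<^sub>0 'k::comm_ring_1. \<forall>a\<in>keys f. P a}"
  unfolding ideal_of_type_iff
proof (intro conjI ballI allI)
  fix f g :: "('v \<Rightarrow>\<^sub>0 nat) \<Rightarrow>\<^sub>0 'k"
  assume "f \<in> {f. \<forall>a\<in>keys f. P a}" "g \<in> {f. \<forall>a\<in>keys f. P a}"
  then show "f + g \<in> {f. \<forall>a\<in>keys f. P a}"
    using Poly_Mapping.keys_add[of f g] by auto
next
  fix f g :: "('v \<Rightarrow>\<^sub>0 nat) \<Rightarrow>\<^sub>0 'k"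
  assume "f \<in> {f. \<forall>a\<in>keys f. P a}"
  then show "g * f \<in> {f. \<forall>a\<in>keys f. P a}"
    using keys_mult[of g f] assms by (fastforce simp: add.commute)
qed auto

lemma poly_mapping_eq_sum_single:
  "f = (\<Sum>a\<in>keys f. single a (lookup f a))"
proof (rule poly_mapping_eqI)
  fix b
  show "lookup f b =
      lookup (\<Sum>a\<in>keys f. single a (lookup f a)) b"
    by (cases "b \<in> keys f")
      (auto simp: lookup_sum lookup_single when_def sum.delta in_keys_iff)
qed

lemma lookup_mult_unique_decomposition:
  fixes f g :: "'a::monoid_add \<Rightarrow>\<^sub>0 'k::comm_ring_1"
  assumes uniq: "\<And>m a. m \<in> keys f \<Longrightarrow> a \<in> keys g \<Longrightarrow> m + a = m0 + a0 \<Longrightarrow> m = m0 \<and> a = a0"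
  shows "lookup (f * g) (m0 + a0) =
    lookup f m0 * lookup g a0"
proof -
  define f' where "f' = f - single m0 (lookup f m0)"
  define g' where "g' = g - single a0 (lookup g a0)"
  have kf: "keys f' \<subseteq> keys f - {m0}" and kg: "keys g' \<subseteq> keys g - {a0}"
    by (auto simp: f'_def g'_def in_keys_iff lookup_minus lookup_single when_def split: if_splits)
  have f: "f = single m0 (lookup f m0) + f'"
    and g: "g = single a0 (lookup g a0) + g'"
    by (auto simp: f'_def g'_def)
  have "m0 + a0 \<notin> keys (f' * g)"
  proof
    assume "m0 + a0 \<in> keys (f' * g)"
    then obtain m a where ma: "m \<in> keys f'" "a \<in> keys g" "m0 + a0 = m + a"
      using keys_mult by blast
    with kf show False using uniq[OF _ ma(2) ma(3)[symmetric]] by blast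
  qed
  moreover have "m0 + a0 \<notin> keys (single m0 (lookup f m0) * g')"
  proof
    assume "m0 + a0 \<in> keys (single m0 (lookup f m0) * g')"
    then obtain m a where ma: "m \<in> keys (single m0 (lookup f m0))"
        "a \<in> keys g'" "m0 + a0 = m + a"
      using keys_mult by blast
    from ma(1) have "m = m0" "m0 \<in> keys f"
      by (auto simp: in_keys_iff lookup_single when_def split: if_splits)
    with ma kg show False using uniq[OF _ _ ma(3)[symmetric]] by blast
  qed
  moreover have "f * g = single (m0 + a0) (lookup f m0 * lookup g a0)
      + single m0 (lookup f m0) * g' + f' * g"
  proof -
    have "f * g = single m0 (lookup f m0) * g + f' * g"
      using arg_cong[OF f, of "\<lambda>x. x * g"] by (simp only: distrib_right)
    also have "single m0 (lookup f m0) * g =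
        single (m0 + a0) (lookup f m0 * lookup g a0)
        + single m0 (lookup f m0) * g'"
      using arg_cong[OF g, of "\<lambda>x. single m0 (lookup f m0) * x"]
      by (simp only: distrib_left mult_single)
    finally show ?thesis .
  qed
  ultimately show ?thesis
    by (simp add: lookup_add in_keys_iff)
qed

text \<open>
  Let \<open>P\<close> be a property of exponent vectors that is closed upwards and does not depend on the variables
  outside \<open>C\<close>. The polynomials whose exponent vectors all satisfy \<open>P\<close> form an ideal, and this ideal
  is the contraction of its extension to the local ring at the prime generated by the variables in
  \<open>C\<close>. A leading term argument shows it: suppose \<open>f\<close> has exponent vectors violating \<open>P\<close>. Take
  \<open>a\<^sub>0\<close> largest (in the linear order on exponent vectors) among those of least degree in the
  variables of \<open>C\<close>, and \<open>m\<^sub>0\<close> largest among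
  the exponent vectors of \<open>h\<close> that do not involve \<open>C\<close>. Then \<open>m\<^sub>0 + a\<^sub>0\<close> violates \<open>P\<close>. In every
  decomposition of it as a sum of exponent vectors of \<open>h\<close> and of \<open>f\<close> the second summand violates \<open>P\<close> as
  well; comparing degrees in \<open>C\<close> and then using maximality shows that there is only one decomposition,
  so the term cannot cancel in \<open>h * f\<close>.
\<close>

lemma keys_saturated:
  fixes f h :: "('v::{finite,linorder}, 'k::field) mpoly"
  assumes up: "\<And>a b. P a \<Longrightarrow> P (a + b)"
    and indep: "\<And>a m. P (m + a) \<Longrightarrow> \<forall>c\<in>C. lookup m c = 0 \<Longrightarrow> P a"
    and h: "m \<in> keys h" "\<forall>c\<in>C. lookup m c = 0"
    and hf: "\<forall>a\<in>keys (h * f). P a"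
  shows "\<forall>a\<in>keys f. P a"
proof (rule ccontr)
  assume "\<not> (\<forall>a\<in>keys f. P a)"
  define deg :: "('v \<Rightarrow>\<^sub>0 nat) \<Rightarrow> nat" where "deg a = (\<Sum>c\<in>C. lookup a c)" for a
  have deg_add: "deg (a + b) = deg a + deg b" for a b
    by (simp add: deg_def lookup_add sum.distrib)
  have deg0: "deg a = 0 \<longleftrightarrow> (\<forall>c\<in>C. lookup a c = 0)" for a
    by (simp add: deg_def)
  define M where "M = {m \<in> keys h. deg m = 0}"
  define B where "B = {a \<in> keys f. \<not> P a}"
  define d where "d = Min (deg ` B)"
  define B' where "B' = {a \<in> B. deg a = d}"
  have "finite B" "B \<noteq> {}" using \<open>\<not> _\<close> by (auto simp: B_def)
  then have "d \<in> deg ` B" and dmin: "\<And>a. a \<in> B \<Longrightarrow> d \<le> deg a" by (auto simp: d_def)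
  then have "finite B'" "B' \<noteq> {}" using \<open>finite B\<close> by (auto simp: B'_def)
  have "finite M" "M \<noteq> {}" using h by (auto simp: M_def deg0)
  define m0 where "m0 = Max M"
  define a0 where "a0 = Max B'"
  have m0: "m0 \<in> M" "\<And>m. m \<in> M \<Longrightarrow> m \<le> m0"
    using \<open>finite M\<close> \<open>M \<noteq> {}\<close> by (auto simp: m0_def)
  have a0: "a0 \<in> B'" "\<And>a. a \<in> B' \<Longrightarrow> a \<le> a0"
    using \<open>finite B'\<close> \<open>B' \<noteq> {}\<close> by (auto simp: a0_def)
  have notP: "\<not> P (m0 + a0)"
    using indep[of m0 a0] m0(1) a0(1) by (auto simp: M_def B'_def B_def deg0)
  have "lookup (h * f) (m0 + a0) = lookup h m0 * lookup f a0"
  proof (rule lookup_mult_unique_decomposition)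
    fix m a assume ma: "m \<in> keys h" "a \<in> keys f" "m + a = m0 + a0"
    have "\<not> P a" using up[of a m] notP ma by (auto simp: add.commute)
    then have "a \<in> B" using ma by (auto simp: B_def)
    have "deg m + deg a = deg m0 + deg a0" using ma deg_add by metis
    then have "deg m = 0" "deg a = d"
      using dmin[OF \<open>a \<in> B\<close>] m0(1) a0(1) by (auto simp: M_def B'_def)
    then have "m \<le> m0" "a \<le> a0"
      using ma \<open>a \<in> B\<close> m0 a0 by (auto simp: M_def B'_def)
    have "m = m0"
    proof (rule ccontr)
      assume "m \<noteq> m0"
      with \<open>m \<le> m0\<close> have "m < m0" by (rule le_neq_trans)
      then have "m + a < m0 + a0" using \<open>a \<le> a0\<close> by (rule add_less_le_mono)
      with ma(3) show False by simp
    qed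
    with ma(3) show "m = m0 \<and> a = a0" by simp
  qed
  moreover have "\<dots> \<noteq> 0"
    using m0(1) a0(1) by (auto simp: M_def B'_def B_def in_keys_iff)
  ultimately have "m0 + a0 \<in> keys (h * f)" by (simp add: in_keys_iff)
  with hf notP show False by blast
qed

section \<open>Powers of the edge ideal\<close>

definition edge_exponent :: "('v \<Rightarrow> nat) \<Rightarrow> 'v \<Rightarrow> 'v \<Rightarrow> ('v \<Rightarrow>\<^sub>0 nat)" where
  "edge_exponent w x y = single x 1 + single y (w y)"

text \<open>
  Divisibility of the monomial with exponent vector \<open>a\<close> by a product of \<open>n\<close> generators.
\<close>

primrec edge_multiple :: "('v \<times> 'v) set \<Rightarrow> ('v \<Rightarrow> nat) \<Rightarrow> nat \<Rightarrow> ('v \<Rightarrow>\<^sub>0 nat) \<Rightarrow> bool" where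
  "edge_multiple ED w 0 a \<longleftrightarrow> True"
| "edge_multiple ED w (Suc n) a \<longleftrightarrow>
     (\<exists>x y b. (x, y) \<in> ED \<and> a = b + edge_exponent w x y \<and> edge_multiple ED w n b)"

lemma edge_multiple_add: "edge_multiple ED w n a \<Longrightarrow> edge_multiple ED w n (a + c)"
proof (induction n arbitrary: a)
  case (Suc n)
  then obtain x y b where "(x, y) \<in> ED" "a = b + edge_exponent w x y" "edge_multiple ED w n b"
    by auto
  then have "a + c = (b + c) + edge_exponent w x y" "edge_multiple ED w n (b + c)"
    using Suc.IH[of b] by (simp_all add: ac_simps)
  then show ?case
    using \<open>(x, y) \<in> ED\<close> unfolding edge_multiple.simps by blast
qed auto

lemma Var_power: "(Var x :: ('v, 'k::field) mpoly) ^ n = single (single x n) 1"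
  by (induction n) (auto simp: Var_def mult_single simp flip: single_add)

lemma edge_generator_eq:
  "(Var x * Var y ^ w y :: ('v, 'k::field) mpoly) = single (edge_exponent w x y) 1"
  by (simp add: Var_power edge_exponent_def mult_single) (simp add: Var_def mult_single)

lemma edge_ideal_is_ideal: "is_ideal (edge_ideal ED w)"
  by (simp add: edge_ideal_def generated_is_ideal)

lemma edge_generator_in_edge_ideal: "(x, y) \<in> ED \<Longrightarrow> Var x * Var y ^ w y \<in> edge_ideal ED w"
  unfolding edge_ideal_def by (rule subsetD[OF generators_in_generated]) blast

lemma edge_ideal_subset_iff:
  "is_ideal J \<Longrightarrow> edge_ideal ED w \<subseteq> J \<longleftrightarrow> (\<forall>(x, y)\<in>ED. Var x * Var y ^ w y \<in> J)"
  using generated_least[of J "{Var x * Var y ^ w y |x y. (x, y) \<in> ED}"]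
    edge_generator_in_edge_ideal[of _ _ ED w]
  unfolding edge_ideal_def by blast

lemma keys_edge_ideal:
  assumes "f \<in> (edge_ideal ED w :: ('v, 'k::field) mpoly set)" "a \<in> keys f"
  shows "\<exists>x y b. (x, y) \<in> ED \<and> a = b + edge_exponent w x y"
proof -
  let ?J = "{f :: ('v, 'k) mpoly. \<forall>a\<in>keys f. edge_multiple ED w (Suc 0) a}"
  have "is_ideal ?J"
    by (rule monomial_ideal) (rule edge_multiple_add)
  then have "edge_ideal ED w \<subseteq> ?J"
    unfolding edge_ideal_subset_iff[OF \<open>is_ideal ?J\<close>]
    by (auto simp: edge_generator_eq) (metis add_0)
  with assms show ?thesis by auto
qed

text \<open>
  One inclusion holds because the right-hand side describes an ideal for each \<open>n\<close>, and multiplying by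
  an element of the edge ideal adds one more generator to every exponent vector. For the other, a
  polynomial is the sum of its terms, each of which is a multiple of a product of \<open>n\<close> generators.
\<close>

lemma mem_edge_ideal_power_iff:
  fixes f :: "('v, 'k::field) mpoly"
  shows "f \<in> ideal_power (edge_ideal ED w) n \<longleftrightarrow> (\<forall>a\<in>keys f. edge_multiple ED w n a)"
proof
  have I: "is_ideal (ideal_power (edge_ideal ED w :: ('v, 'k) mpoly set) n)" for n
    by (intro ideal_power_is_ideal edge_ideal_is_ideal)
  show "\<forall>a\<in>keys f. edge_multiple ED w n a" if "f \<in> ideal_power (edge_ideal ED w) n"
    using that
  proof (induction n arbitrary: f)
    case (Suc n)
    from Suc.prems show ?case
    proof (induction rule: ideal_power_Suc_induct)
      case (mult f g)
      show ?case
      proof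
        fix c assume "c \<in> keys (f * g)"
        then obtain a b where ab: "a \<in> keys f" "b \<in> keys g" "c = a + b"
          using keys_mult by blast
        then obtain x y b' where "(x, y) \<in> ED" "b = b' + edge_exponent w x y"
          using keys_edge_ideal[OF mult(2)] by blast
        moreover have "edge_multiple ED w n (a + b')"
          using Suc.IH[OF mult(1)] ab by (simp add: edge_multiple_add)
        ultimately show "edge_multiple ED w (Suc n) c"
          using ab(3) unfolding edge_multiple.simps by (metis add.assoc)
      qed
    next
      case (add f g)
      then show ?case using Poly_Mapping.keys_add[of f g] by blast
    qed
  qed auto
  have mono: "single a c \<in> ideal_power (edge_ideal ED w) n"
    if "edge_multiple ED w n a" for a and c :: 'k
    using that
  proof (induction n arbitrary: a)
    case 0
    then show ?case by (simp add: ideal_power_0)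
  next
    case (Suc n)
    then obtain x y b where b: "(x, y) \<in> ED" "a = b + edge_exponent w x y" "edge_multiple ED w n b"
      by auto
    then have "single b c * (Var x * Var y ^ w y) \<in> ideal_power (edge_ideal ED w) (Suc n)"
      using Suc.IH by (intro ideal_power_mult_generator edge_generator_in_edge_ideal)
    then show ?case using b by (simp add: edge_generator_eq mult_single)
  qed
  show "f \<in> ideal_power (edge_ideal ED w) n" if "\<forall>a\<in>keys f. edge_multiple ED w n a"
    by (subst poly_mapping_eq_sum_single[of f], rule ideal_sum[OF I]) (use that mono in blast)
qed

section \<open>Vertex covers and minimal primes\<close>

definition vertex_cover :: "('v \<times> 'v) set \<Rightarrow> 'v set \<Rightarrow> bool" where
  "vertex_cover ED C \<longleftrightarrow> (\<forall>(x, y)\<in>ED. x \<in> C \<or> y \<in> C)"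

definition minimal_vertex_cover :: "('v \<times> 'v) set \<Rightarrow> 'v set \<Rightarrow> bool" where
  "minimal_vertex_cover ED C \<longleftrightarrow> vertex_cover ED C \<and> (\<forall>v\<in>C. \<not> vertex_cover ED (C - {v}))"

lemma vertex_cover_mono: "vertex_cover ED C \<Longrightarrow> C \<subseteq> C' \<Longrightarrow> vertex_cover ED C'"
  unfolding vertex_cover_def by blast

lemma minimal_vertex_cover_subset_eq:
  assumes "minimal_vertex_cover ED C" "vertex_cover ED C'" "C' \<subseteq> C"
  shows "C' = C"
proof (rule ccontr)
  assume "C' \<noteq> C"
  with assms(3) obtain v where "v \<in> C" "C' \<subseteq> C - {v}" by blast
  with assms show False
    using vertex_cover_mono[of ED C' "C - {v}"] by (auto simp: minimal_vertex_cover_def)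
qed

lemma vertex_cover_contains_minimal:
  assumes "finite C" "vertex_cover ED C"
  shows "\<exists>C'\<subseteq>C. minimal_vertex_cover ED C'"
  using assms
proof (induction C rule: finite_psubset_induct)
  case (psubset C)
  show ?case
  proof (cases "minimal_vertex_cover ED C")
    case False
    with psubset.prems obtain v where "v \<in> C" "vertex_cover ED (C - {v})"
      by (auto simp: minimal_vertex_cover_def)
    then obtain C' where "C' \<subseteq> C - {v}" "minimal_vertex_cover ED C'"
      using psubset.IH[of "C - {v}"] by blast
    then show ?thesis by blast
  qed auto
qed

lemma minimal_vertex_cover_neighbour:
  assumes "minimal_vertex_cover ED C" "v \<in> C" "(v, v) \<notin> ED"
  shows "\<exists>u. u \<notin> C \<and> ((u, v) \<in> ED \<or> (v, u) \<in> ED)"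
  using assms unfolding minimal_vertex_cover_def vertex_cover_def by fast

definition variables_prime :: "'v set \<Rightarrow> ('v, 'k::field) mpoly set" where
  "variables_prime C = {f. \<forall>a\<in>keys f. \<exists>c\<in>C. lookup a c \<noteq> 0}"

text \<open>
  Involving some variable of \<open>C\<close> is a property of exponent vectors to which cancellation of a factor
  outside the ideal applies; for this property it is primality.
\<close>

lemma prime_variables_prime:
  "primeideal (variables_prime C :: ('v::{finite,linorder}, 'k::field) mpoly set) ring_of_type_algebra"
  unfolding primeideal_of_type_iff
proof (intro conjI allI impI)
  show "is_ideal (variables_prime C :: ('v, 'k) mpoly set)"
    unfolding variables_prime_def by (rule monomial_ideal) (auto simp: lookup_add)
  show "1 \<notin> (variables_prime C :: ('v, 'k) mpoly set)"
    by (simp add: variables_prime_def)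
  fix h f :: "('v, 'k) mpoly"
  assume hf: "h * f \<in> variables_prime C"
  show "h \<in> variables_prime C \<or> f \<in> variables_prime C"
  proof (rule disjCI)
    assume "f \<notin> variables_prime C"
    show "h \<in> variables_prime C"
    proof (rule ccontr)
      assume "h \<notin> variables_prime C"
      then obtain m where m: "m \<in> keys h" "\<forall>c\<in>C. lookup m c = 0"
        by (auto simp: variables_prime_def)
      have "\<forall>a\<in>keys f. \<exists>c\<in>C. lookup a c \<noteq> 0"
        by (rule keys_saturated[where P = "\<lambda>a. \<exists>c\<in>C. lookup a c \<noteq> 0", OF _ _ m])
          (use hf in \<open>auto simp: variables_prime_def lookup_add\<close>)
      with \<open>f \<notin> variables_prime C\<close> show False by (auto simp: variables_prime_def)
    qed
  qed
qed

lemma Var_in_variables_prime_iff: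
  "(Var v :: ('v, 'k::field) mpoly) \<in> variables_prime C \<longleftrightarrow> v \<in> C"
  by (auto simp: variables_prime_def Var_def lookup_single when_def split: if_splits)

text \<open>
  So \<open>variables_prime C\<close> is the ideal generated by the variables of \<open>C\<close>.
\<close>

lemma variables_prime_least:
  fixes J :: "('v, 'k::field) mpoly set"
  assumes J: "is_ideal J" and C: "\<And>c. c \<in> C \<Longrightarrow> Var c \<in> J"
  shows "variables_prime C \<subseteq> J"
proof
  fix f :: "('v, 'k) mpoly"
  assume f: "f \<in> variables_prime C"
  have "single a (lookup f a) \<in> J" if a: "a \<in> keys f" for a
  proof -
    obtain c where c: "c \<in> C" "lookup a c \<noteq> 0"
      using f a by (auto simp: variables_prime_def)
    have "(a - single c 1) + single c 1 = a"
      using c by (intro poly_mapping_eqI) (auto simp: lookup_add lookup_minus lookup_single when_def)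
    then have "single a (lookup f a) = single (a - single c 1) (lookup f a) * Var c"
      by (simp add: Var_def mult_single)
    moreover have "single (a - single c 1) (lookup f a) * Var c \<in> J"
      using J C[OF c(1)] by (simp add: ideal_of_type_iff)
    ultimately show ?thesis by simp
  qed
  then show "f \<in> J"
    by (subst poly_mapping_eq_sum_single[of f], intro ideal_sum[OF J])
qed

lemma prime_power_mem_iff:
  assumes p: "primeideal p (ring_of_type_algebra :: 'a::comm_ring_1 ring)" and "n \<ge> 1"
  shows "a ^ n \<in> p \<longleftrightarrow> a \<in> p"
proof
  show "a \<in> p" if "a ^ n \<in> p"
    using that by (induction n) (use p in \<open>auto simp: primeideal_of_type_iff\<close>)
  obtain m where "n = Suc m" using \<open>n \<ge> 1\<close> by (cases n) auto
  then show "a ^ n \<in> p" if "a \<in> p"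
    using that p by (auto simp: primeideal_of_type_iff ideal_of_type_iff mult.commute[of a])
qed

text \<open>
  A prime ideal contains a generator exactly if it contains one of its two variables, since the
  weights are positive.
\<close>

lemma edge_ideal_subset_prime_iff:
  fixes p :: "('v, 'k::field) mpoly set"
  assumes p: "primeideal p ring_of_type_algebra" and w: "\<And>v. w v \<ge> 1"
  shows "edge_ideal ED w \<subseteq> p \<longleftrightarrow> vertex_cover ED {v. Var v \<in> p}"
proof -
  have id: "is_ideal p" using p by (simp add: primeideal_of_type_iff)
  have "Var x * Var y ^ w y \<in> p \<longleftrightarrow> Var x \<in> p \<or> Var y \<in> p" for x y
  proof -
    have "Var x * Var y ^ w y \<in> p \<longleftrightarrow> Var x \<in> p \<or> Var y ^ w y \<in> p"
      using p by (auto simp: primeideal_of_type_iff ideal_of_type_iff mult.commute)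
    then show ?thesis using prime_power_mem_iff[OF p w] by simp
  qed
  then show ?thesis
    unfolding edge_ideal_subset_iff[OF id] vertex_cover_def by simp
qed

text \<open>
  The variables in a prime over the edge ideal form a vertex cover, and the prime contains the ideal
  generated by any smaller cover; so minimality of the prime and of the cover correspond.
\<close>

lemma minimal_primes_edge_ideal:
  assumes w: "\<And>v. w v \<ge> 1"
  shows "minimal_primes (edge_ideal ED w :: ('v::{finite,linorder}, 'k::field) mpoly set) =
    variables_prime ` {C. minimal_vertex_cover ED C}"
proof -
  let ?I = "edge_ideal ED w :: ('v, 'k) mpoly set"
  have sub: "?I \<subseteq> variables_prime C \<longleftrightarrow> vertex_cover ED C" for C
    using edge_ideal_subset_prime_iff[OF prime_variables_prime[of C] w, where ED = ED]
    by (simp add: Var_in_variables_prime_iff)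
  have least: "variables_prime C \<subseteq> p"
    if "primeideal p ring_of_type_algebra" "C \<subseteq> {v. Var v \<in> p}" for p :: "('v, 'k) mpoly set" and C
    using that by (intro variables_prime_least) (auto simp: primeideal_of_type_iff)
  show ?thesis
  proof (intro Set.set_eqI iffI)
    fix p assume "p \<in> minimal_primes ?I"
    then have mp: "(primeideal p ring_of_type_algebra \<and> ?I \<subseteq> p) \<and>
        (\<forall>q. primeideal q ring_of_type_algebra \<and> ?I \<subseteq> q \<and> q \<subseteq> p \<longrightarrow> q = p)"
      unfolding minimal_primes_def mem_Collect_eq conj_assoc .
    note p = mp[THEN conjunct1, THEN conjunct1] mp[THEN conjunct1, THEN conjunct2]
    note min = mp[THEN conjunct2, rule_format, OF conjI, OF _ conjI]
    have "vertex_cover ED {v. Var v \<in> p}"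
      using p(2) unfolding edge_ideal_subset_prime_iff[OF p(1) w] .
    then obtain C where C: "C \<subseteq> {v. Var v \<in> p}" "minimal_vertex_cover ED C"
      using vertex_cover_contains_minimal[OF finite] by blast
    have "?I \<subseteq> variables_prime C"
      using sub C(2) by (simp add: minimal_vertex_cover_def)
    from min[OF prime_variables_prime this least[OF p(1) C(1)]] C(2)
    show "p \<in> variables_prime ` {C. minimal_vertex_cover ED C}"
      by (intro image_eqI[of _ _ C]) simp_all
  next
    fix p :: "('v, 'k) mpoly set"
    assume "p \<in> variables_prime ` {C. minimal_vertex_cover ED C}"
    then obtain C where C: "minimal_vertex_cover ED C" "p = variables_prime C" by blast
    have eq: "q = p" if q: "primeideal q ring_of_type_algebra" "?I \<subseteq> q" "q \<subseteq> p" for q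
    proof -
      have "vertex_cover ED {v. Var v \<in> q}"
        using q(2) unfolding edge_ideal_subset_prime_iff[OF q(1) w] .
      moreover have "{v. Var v \<in> q} \<subseteq> C"
        by (auto simp: Var_in_variables_prime_iff dest!: subsetD[OF q(3)[unfolded C(2)]])
      ultimately have "{v. Var v \<in> q} = C"
        by (rule minimal_vertex_cover_subset_eq[OF C(1)])
      then have "p \<subseteq> q" using least[OF q(1), of C] C(2) by simp
      with q(3) show ?thesis by (rule subset_antisym)
    qed
    show "p \<in> minimal_primes ?I"
      unfolding minimal_primes_def mem_Collect_eq
    proof (intro conjI allI impI)
      show "primeideal p ring_of_type_algebra" using C by (simp add: prime_variables_prime)
      show "?I \<subseteq> p" using C sub by (simp add: minimal_vertex_cover_def)
    qed (use eq in simp)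
  qed
qed

lemma mem_symbolic_power_edge_ideal_iff:
  fixes f :: "('v::{finite,linorder}, 'k::field) mpoly"
  assumes "\<And>v. w v \<ge> 1"
  shows "f \<in> symbolic_power (edge_ideal ED w) n \<longleftrightarrow>
    (\<forall>C. minimal_vertex_cover ED C \<longrightarrow>
       (\<exists>h. h \<notin> variables_prime C \<and> h * f \<in> ideal_power (edge_ideal ED w) n))"
  unfolding mem_symbolic_power_iff[OF edge_ideal_is_ideal] minimal_primes_edge_ideal[OF assms]
  by simp

section \<open>Membership in powers locally at a minimal prime\<close>

lemma ideal_power_antimono:
  assumes I: "is_ideal I" and "m \<le> n"
  shows "ideal_power I n \<subseteq> ideal_power I m"
  using \<open>m \<le> n\<close>
proof (induction n rule: dec_induct)
  case (step n)
  have "ideal_power I (Suc n) \<subseteq> ideal_power I n"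
  proof
    fix x assume "x \<in> ideal_power I (Suc n)"
    then show "x \<in> ideal_power I n"
      by (induction rule: ideal_power_Suc_induct)
        (use ideal_power_is_ideal[OF I, of n] in \<open>auto simp: ideal_of_type_iff mult.commute\<close>)
  qed
  with step show ?case by blast
qed auto

text \<open>
  Membership in the power of exponent \<open>n\<close> after localizing at \<open>variables_prime C\<close>.
\<close>

definition locally_in_power :: "('v \<times> 'v) set \<Rightarrow> ('v \<Rightarrow> nat) \<Rightarrow> 'v set \<Rightarrow> nat \<Rightarrow>
    ('v, 'k::field) mpoly \<Rightarrow> bool" where
  "locally_in_power ED w C n f \<longleftrightarrow>
     (\<exists>h. h \<notin> variables_prime C \<and> h * f \<in> ideal_power (edge_ideal ED w) n)"

lemma locally_in_power_mult:
  fixes f g :: "('v::{finite,linorder}, 'k::field) mpoly"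
  assumes "locally_in_power ED w C m f" "locally_in_power ED w C n g"
  shows "locally_in_power ED w C (m + n) (f * g)"
  using locally_in_ideal_power_mult[OF edge_ideal_is_ideal prime_variables_prime] assms
  unfolding locally_in_power_def by blast

lemma one_notin_variables_prime: "(1 :: ('v, 'k::field) mpoly) \<notin> variables_prime C"
  by (simp add: variables_prime_def)

lemma locally_in_power_0: "locally_in_power ED w C 0 f"
  unfolding locally_in_power_def using one_notin_variables_prime by (auto simp: ideal_power_0)

lemma locally_in_power_multiple:
  fixes f g :: "('v::{finite,linorder}, 'k::field) mpoly"
  shows "locally_in_power ED w C n f \<Longrightarrow> locally_in_power ED w C n (f * g)"
  using locally_in_power_mult[OF _ locally_in_power_0, of ED w C n f g] by simp

lemma locally_in_power_power:
  fixes f :: "('v::{finite,linorder}, 'k::field) mpoly"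
  assumes "locally_in_power ED w C 1 f"
  shows "locally_in_power ED w C n (f ^ n)"
proof (induction n)
  case (Suc n)
  from locally_in_power_mult[OF Suc.IH assms] show ?case by (simp add: mult.commute)
qed (rule locally_in_power_0)

lemma locally_in_power_prod:
  fixes f :: "'a \<Rightarrow> ('v::{finite,linorder}, 'k::field) mpoly"
  assumes "finite M" "\<And>i. i \<in> M \<Longrightarrow> locally_in_power ED w C (n i) (f i)"
  shows "locally_in_power ED w C (sum n M) (prod f M)"
  using assms
proof (induction M rule: finite_induct)
  case empty
  show ?case by (simp add: locally_in_power_0)
next
  case (insert i M)
  then show ?case by (simp add: locally_in_power_mult)
qed

lemma locally_in_power_edge:
  assumes "(x, y) \<in> ED"
  shows "locally_in_power ED w C 1 (Var x * Var y ^ w y :: ('v, 'k::field) mpoly)"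
  unfolding locally_in_power_def
  by (intro exI[of _ 1])
    (simp add: one_notin_variables_prime ideal_power_1[OF edge_ideal_is_ideal]
      edge_generator_in_edge_ideal[OF assms])

lemma Var_power_notin_variables_prime:
  "u \<notin> C \<Longrightarrow> (Var u ^ n :: ('v, 'k::field) mpoly) \<notin> variables_prime C"
  by (auto simp: variables_prime_def Var_power lookup_single when_def)

lemma Var_locally_in_power:
  assumes "(v, u) \<in> ED" "u \<notin> C"
  shows "locally_in_power ED w C 1 (Var v :: ('v, 'k::field) mpoly)"
  unfolding locally_in_power_def
  by (intro exI[of _ "Var u ^ w u"])
    (simp add: Var_power_notin_variables_prime[OF assms(2)] ideal_power_1[OF edge_ideal_is_ideal]
      mult.commute[of _ "Var v"] edge_generator_in_edge_ideal[OF assms(1)])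

text \<open>
  By minimality of the cover, \<open>v\<close> has a neighbour \<open>u\<close> outside it, and the variable of \<open>u\<close> is a unit
  locally. Depending on the direction of the edge, the generator becomes \<open>Var v ^ w v\<close> or \<open>Var v\<close>
  up to a unit.
\<close>

lemma Var_power_locally_in_power:
  assumes C: "minimal_vertex_cover ED C" "v \<in> C" and loop: "(v, v) \<notin> ED" and w: "w v \<ge> 1"
  shows "locally_in_power ED w C 1 (Var v ^ w v :: ('v::{finite,linorder}, 'k::field) mpoly)"
proof -
  obtain u where u: "u \<notin> C" "(u, v) \<in> ED \<or> (v, u) \<in> ED"
    using minimal_vertex_cover_neighbour[OF C loop] by blast
  show ?thesis
  proof (cases "(u, v) \<in> ED")
    case True
    have "(Var u ^ 1 :: ('v, 'k) mpoly) \<notin> variables_prime C"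
      by (rule Var_power_notin_variables_prime[OF u(1)])
    moreover have "(Var u * Var v ^ w v :: ('v, 'k) mpoly) \<in> ideal_power (edge_ideal ED w) 1"
      using edge_generator_in_edge_ideal[OF True] by (simp add: ideal_power_1[OF edge_ideal_is_ideal])
    ultimately show ?thesis unfolding locally_in_power_def by auto
  next
    case False
    with u have "locally_in_power ED w C 1 (Var v * Var v ^ (w v - 1) :: ('v, 'k) mpoly)"
      by (intro locally_in_power_multiple Var_locally_in_power[of v u]) auto
    then show ?thesis using w by (cases "w v") auto
  qed
qed

section \<open>A weighted vertex with an outgoing edge separates the squares\<close>

lemma edge_multiple_SucE:
  assumes "edge_multiple ED w (Suc n) a"
  obtains x y b where "(x, y) \<in> ED" "a = b + edge_exponent w x y" "edge_multiple ED w n b"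
  using assms by auto

text \<open>
  The edges of two generators dividing the monomial would have to lie within \<open>{x, y, z}\<close>. The exponent
  1 at \<open>x\<close> and the exponent \<open>w z\<close> at \<open>z\<close> leave only the two edges \<open>(x, y)\<close> and \<open>(y, z)\<close>, one time each;
  but these need the exponent \<open>w y + 1\<close> at \<open>y\<close>.
\<close>

lemma path_not_edge_multiple:
  assumes asym: "\<And>x y. (x, y) \<in> ED \<Longrightarrow> (y, x) \<notin> ED" and w: "\<And>v. w v \<ge> 1"
    and xy: "(x, y) \<in> ED" and yz: "(y, z) \<in> ED" and wy: "w y \<ge> 2"
  shows "\<not> edge_multiple ED w 2 (single x 1 + single y (w y) + single z (w z))"
proof
  let ?a = "single x 1 + single y (w y) + single z (w z)"
  assume "edge_multiple ED w 2 ?a"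
  then have "edge_multiple ED w (Suc (Suc 0)) ?a" by (simp only: numeral_2_eq_2)
  then obtain p q c where pq: "(p, q) \<in> ED" "?a = c + edge_exponent w p q"
    and "edge_multiple ED w (Suc 0) c"
    by (rule edge_multiple_SucE)
  from this(3) obtain p' q' b where pq': "(p', q') \<in> ED" "c = b + edge_exponent w p' q'"
    by (rule edge_multiple_SucE)
  have eq: "lookup ?a v = lookup (b + edge_exponent w p' q' + edge_exponent w p q) v" for v
    using pq(2) unfolding pq'(2) by (rule arg_cong)
  have le: "of_bool (v = p) + of_bool (v = q) * w q + of_bool (v = p') + of_bool (v = q') * w q'
      \<le> of_bool (v = x) + of_bool (v = y) * w y + of_bool (v = z) * w z" for v
  proof -
    have single: "lookup (single u k) v = of_bool (v = u) * k" for u :: 'a and k :: nat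
      by (simp add: lookup_single when_def)
    show ?thesis
      using eq[of v] unfolding edge_exponent_def lookup_add single by linarith
  qed
  have ne: "x \<noteq> y" "y \<noteq> z" "z \<noteq> x"
    using asym[OF xy] asym[OF yz] xy yz by auto
  have nE: "(y, x) \<notin> ED" "(z, y) \<notin> ED" "(v, v) \<notin> ED" for v
    using asym[OF xy] asym[OF yz] asym[of v v] by auto
  have w1: "w v > 0" for v using w[of v] by simp
  have ends: "p = x \<or> p = y \<or> p = z" "q = x \<or> q = y \<or> q = z"
    "p' = x \<or> p' = y \<or> p' = z" "q' = x \<or> q' = y \<or> q' = z"
    using le[of p] le[of q] le[of p'] le[of q'] w1[of q] w1[of q']
    by (auto simp: of_bool_def split: if_splits)
  have c: "p = x \<and> q = y \<or> p = y \<and> q = z \<or> p = x \<and> q = z \<or> p = z \<and> q = x"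
    using ends pq(1) nE by auto
  have c': "p' = x \<and> q' = y \<or> p' = y \<and> q' = z \<or> p' = x \<and> q' = z \<or> p' = z \<and> q' = x"
    using ends pq'(1) nE by auto
  show False
    using c c' le[of x] le[of y] le[of z] ne w1[of x] w1[of y] w1[of z] wy
    by (elim disjE conjE) simp_all
qed

text \<open>
  Let \<open>C\<close> be a minimal cover. If \<open>z \<in> C\<close>, the two factors of the square are the generator of \<open>(x, y)\<close> and
  \<open>Var z ^ w z\<close>. If \<open>z \<notin> C\<close>, the generator of \<open>(y, z)\<close> is \<open>Var y\<close> up to a unit, and
  \<open>Var y ^ 2\<close> divides the monomial because \<open>w y \<ge> 2\<close>.
\<close>

lemma path_in_symbolic_square:
  fixes ED :: "('v::{finite,linorder} \<times> 'v) set"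
  assumes loop: "\<And>v. (v, v) \<notin> ED" and w: "\<And>v. w v \<ge> 1"
    and xy: "(x, y) \<in> ED" and yz: "(y, z) \<in> ED" and wy: "w y \<ge> 2"
  shows "(Var x * Var y ^ w y * Var z ^ w z :: ('v, 'k::field) mpoly)
    \<in> symbolic_power (edge_ideal ED w) 2"
  unfolding mem_symbolic_power_edge_ideal_iff[OF w]
proof (intro allI impI, fold locally_in_power_def)
  fix C assume C: "minimal_vertex_cover ED C"
  show "locally_in_power ED w C 2 (Var x * Var y ^ w y * Var z ^ w z :: ('v, 'k) mpoly)"
  proof (cases "z \<in> C")
    case True
    have "locally_in_power ED w C (1 + 1) (Var x * Var y ^ w y * Var z ^ w z :: ('v, 'k) mpoly)"
      by (intro locally_in_power_mult locally_in_power_edge xy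
          Var_power_locally_in_power C True loop w)
    then show ?thesis by (simp add: numeral_2_eq_2)
  next
    case False
    have "locally_in_power ED w C 1 (Var y :: ('v, 'k) mpoly)"
      by (rule Var_locally_in_power[OF yz False])
    then have "locally_in_power ED w C 2 (Var y ^ 2 * (Var y ^ (w y - 2) * Var x * Var z ^ w z) :: ('v, 'k) mpoly)"
      by (intro locally_in_power_multiple locally_in_power_power)
    moreover have "(Var y ^ 2 * Var y ^ (w y - 2) :: ('v, 'k) mpoly) = Var y ^ w y"
      unfolding power_add[symmetric] using wy by (simp only: le_add_diff_inverse)
    ultimately show ?thesis by (simp add: mult_ac)
  qed
qed

section \<open>An odd closed walk separates symbolic from ordinary powers\<close>

text \<open>
  The weight \<open>b v\<close> is the number of visits to \<open>v\<close> of a closed walk of length \<open>2 * k + 1\<close>. Among any two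
  consecutive positions of the walk a cover contains one, so it contains more than half of all
  positions. The walk is found in the bipartite double cover of the graph: if no vertex were connected
  there to its copy, the connected components would give a 2-colouring.
\<close>

lemma odd_closed_walk_weights:
  fixes ED :: "('v::finite \<times> 'v) set"
  assumes nonbip: "\<nexists>A. \<forall>(x, y)\<in>ED. x \<in> A \<longleftrightarrow> y \<notin> A"
  shows "\<exists>(b :: 'v \<Rightarrow> nat) k. sum b UNIV = 2 * k + 1 \<and>
    (\<forall>C. vertex_cover ED C \<longrightarrow> k + 1 \<le> sum b C)"
proof -
  define R where "R = {((x, p), (y, \<not> p)) |x y p. (x, y) \<in> ED \<or> (y, x) \<in> ED}"
  have "sym R" by (auto simp: R_def sym_def)
  then have rev: "(s, t) \<in> R\<^sup>* \<Longrightarrow> (t, s) \<in> R\<^sup>*" for s t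
    using sym_rtrancl[of R] by (auto dest: symD)
  have step: "(s, (y, \<not> p)) \<in> R\<^sup>*" if "(s, (x, p)) \<in> R\<^sup>*" "(x, y) \<in> ED \<or> (y, x) \<in> ED" for s x y p
    by (rule rtrancl_into_rtrancl[OF that(1)]) (use that(2) in \<open>auto simp: R_def\<close>)
  have "\<exists>x. ((x, False), (x, True)) \<in> R\<^sup>*"
  proof (rule ccontr)
    assume no: "\<not> ?thesis"
    \<comment> \<open>In each component a root is chosen, and \<open>A\<close> consists of the vertices joined to it
        by a walk of even length.\<close>
    define reach where "reach x y \<longleftrightarrow> (\<exists>p. ((y, False), (x, p)) \<in> R\<^sup>*)" for x y
    define r where "r x = (SOME y. reach x y)" for x
    have r: "reach x (r x)" for x
      unfolding r_def by (rule someI[of _ x]) (auto simp: reach_def)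
    define A where "A = {x. ((r x, False), (x, False)) \<in> R\<^sup>*}"
    have reach_step: "reach y z" if "reach x z" "(x, y) \<in> ED \<or> (y, x) \<in> ED" for x y z
      using that(1) step[OF _ that(2)] unfolding reach_def by metis
    have colour: "x \<in> A \<longleftrightarrow> y \<notin> A" if xy: "(x, y) \<in> ED" for x y
    proof -
      have "reach x = reach y"
        using xy by (intro ext iffI) (erule reach_step, simp)+
      then have rr: "r x = r y" by (simp add: r_def)
      show ?thesis
      proof
        assume "x \<in> A"
        then have "((r x, False), (y, True)) \<in> R\<^sup>*"
          using step[of "(r x, False)" x False y] xy by (simp add: A_def)
        show "y \<notin> A"
        proof
          assume "y \<in> A"
          then have "((r x, False), (y, False)) \<in> R\<^sup>*" using rr by (simp add: A_def)
          then have "((y, False), (r x, False)) \<in> R\<^sup>*" by (rule rev)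
          then have "((y, False), (y, True)) \<in> R\<^sup>*"
            using \<open>((r x, False), (y, True)) \<in> R\<^sup>*\<close> by (rule rtrancl_trans)
          with no show False by simp
        qed
      next
        assume "y \<notin> A"
        obtain p where p: "((r y, False), (y, p)) \<in> R\<^sup>*"
          using r[of y] unfolding reach_def by blast
        with \<open>y \<notin> A\<close> have p by (cases p) (simp_all add: A_def)
        with p rr have "((r x, False), (y, True)) \<in> R\<^sup>*" by simp
        then show "x \<in> A" using step[of "(r x, False)" y True x] xy by (simp add: A_def)
      qed
    qed
    have "\<forall>(x, y)\<in>ED. x \<in> A \<longleftrightarrow> y \<notin> A"
      by (intro ballI, rule case_prodI2, rule colour, simp)
    with nonbip show False by blast
  qed
  then obtain x where x: "((x, False), (x, True)) \<in> R\<^sup>*" by blast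
  \<comment> \<open>The positions of the walk are counted without the starting point \<open>x\<close>. Each step has an end
      in \<open>C\<close>, and summing over the steps counts inner positions twice, the ends \<open>x\<close> and \<open>y\<close> once; this
      is the inequality.\<close>
  have "\<exists>b :: 'v \<Rightarrow> nat. (odd (sum b UNIV) \<longleftrightarrow> p) \<and> (\<forall>C. vertex_cover ED C \<longrightarrow>
      sum b UNIV + of_bool (y \<in> C) \<le> 2 * sum b C + of_bool (x \<in> C))"
    if "((x, False), (y, p)) \<in> R\<^sup>*" for y p
    using that
  proof (induction rule: rtrancl_induct2)
    case refl
    show ?case by (rule exI[of _ "\<lambda>_. 0"]) simp
  next
    case (step y p z q)
    then obtain b :: "'v \<Rightarrow> nat" where b: "odd (sum b UNIV) \<longleftrightarrow> p"
      "\<And>C. vertex_cover ED C \<Longrightarrow>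
        sum b UNIV + of_bool (y \<in> C) \<le> 2 * sum b C + of_bool (x \<in> C)"
      by blast
    have yz: "(y, z) \<in> ED \<or> (z, y) \<in> ED" "q \<longleftrightarrow> \<not> p" using step.hyps(2) by (auto simp: R_def)
    define b' where "b' v = b v + of_bool (v = z)" for v
    have sum: "sum b' C = sum b C + of_bool (z \<in> C)" for C
      by (simp add: b'_def sum.distrib of_bool_def sum.delta)
    have "sum b' UNIV + of_bool (z \<in> C) \<le> 2 * sum b' C + of_bool (x \<in> C)"
      if C: "vertex_cover ED C" for C
    proof -
      have "y \<in> C \<or> z \<in> C" using C yz by (auto simp: vertex_cover_def)
      then show ?thesis using b(2)[OF C] by (auto simp: sum)
    qed
    moreover have "odd (sum b' UNIV) \<longleftrightarrow> q" using b(1) yz by (simp add: sum)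
    ultimately show ?case by blast
  qed
  from this[OF x] obtain b :: "'v \<Rightarrow> nat" where b: "odd (sum b UNIV)"
    "\<And>C. vertex_cover ED C \<Longrightarrow>
      sum b UNIV + of_bool (x \<in> C) \<le> 2 * sum b C + of_bool (x \<in> C)"
    by blast
  from b(1) obtain k where k: "sum b UNIV = 2 * k + 1" by (rule oddE)
  have "k + 1 \<le> sum b C" if "vertex_cover ED C" for C
    using b(2)[OF that] k by simp
  with k show ?thesis by blast
qed

text \<open>
  In the grading that gives degree \<open>1 / w v\<close> to the variable of \<open>v\<close>, a generator has degree 2, because
  its tail has weight 1.
\<close>

lemma weighted_degree_edge_multiple:
  fixes ED :: "('v::finite \<times> 'v) set"
  assumes w: "\<And>v. w v \<ge> 1" and tail: "\<And>x y. (x, y) \<in> ED \<Longrightarrow> w x = 1"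
    and a: "edge_multiple ED w n a"
  shows "2 * real n \<le> (\<Sum>v\<in>UNIV. real (lookup a v) / real (w v))"
  using a
proof (induction n arbitrary: a)
  case 0
  show ?case by (simp add: sum_nonneg)
next
  case (Suc n)
  then obtain x y b where b: "(x, y) \<in> ED" "a = b + edge_exponent w x y" "edge_multiple ED w n b"
    by auto
  have "w y > 0" using w[of y] by simp
  then have "real (lookup a v) / real (w v) =
      real (lookup b v) / real (w v) + ((if v = x then 1 else 0) + (if v = y then 1 else 0))" for v
    using tail[OF b(1)]
    by (auto simp: b(2) edge_exponent_def lookup_add lookup_single when_def add_divide_distrib)
  then have "(\<Sum>v\<in>UNIV. real (lookup a v) / real (w v)) =
      (\<Sum>v\<in>UNIV. real (lookup b v) / real (w v)) + 2"
    by (simp add: sum.distrib)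
  with Suc.IH[OF b(3)] show ?case by simp
qed

lemma prod_Var_powers:
  "finite M \<Longrightarrow> (\<Prod>v\<in>M. Var v ^ c v :: ('v, 'k::field) mpoly) = single (\<Sum>v\<in>M. single v (c v)) 1"
  by (induction M rule: finite_induct) (simp_all add: Var_power mult_single)

text \<open>
  Locally at a minimal cover \<open>C\<close> each factor \<open>Var v ^ w v\<close> with \<open>v \<in> C\<close> counts for one power of the edge
  ideal, which makes \<open>sum b C \<ge> k + 1\<close> altogether; but the degree of the monomial is only \<open>2 * k + 1\<close>.
\<close>

lemma symbolic_not_ordinary_if_odd_weights:
  fixes ED :: "('v::{finite,linorder} \<times> 'v) set" and b :: "'v \<Rightarrow> nat"
  assumes loop: "\<And>v. (v, v) \<notin> ED" and w: "\<And>v. w v \<ge> 1"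
    and tail: "\<And>x y. (x, y) \<in> ED \<Longrightarrow> w x = 1"
    and total: "sum b UNIV = 2 * k + 1"
    and covers: "\<And>C. vertex_cover ED C \<Longrightarrow> k + 1 \<le> sum b C"
  shows "(\<Prod>v\<in>UNIV. Var v ^ (w v * b v) :: ('v, 'k::field) mpoly)
    \<in> symbolic_power (edge_ideal ED w) (k + 1) - ideal_power (edge_ideal ED w) (k + 1)"
proof
  let ?f = "\<Prod>v\<in>UNIV. Var v ^ (w v * b v) :: ('v, 'k) mpoly"
  define a where "a = (\<Sum>v\<in>UNIV. single v (w v * b v))"
  have f: "?f = single a 1" by (simp add: prod_Var_powers a_def)
  have a: "lookup a v = w v * b v" for v
    by (simp add: a_def lookup_sum lookup_single when_def sum.delta)
  have w0: "real (w v) \<noteq> 0" for v using w[of v] by simp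
  show "?f \<notin> ideal_power (edge_ideal ED w) (k + 1)"
  proof
    assume "?f \<in> ideal_power (edge_ideal ED w) (k + 1)"
    then have "edge_multiple ED w (k + 1) a"
      unfolding mem_edge_ideal_power_iff f by simp
    from weighted_degree_edge_multiple[OF w _ this]
    have "2 * real (k + 1) \<le> (\<Sum>v\<in>UNIV. real (lookup a v) / real (w v))"
      using tail by simp
    also have "\<dots> = real (sum b UNIV)"
      using w0 by (simp add: a)
    finally show False using total by simp
  qed
  show "?f \<in> symbolic_power (edge_ideal ED w) (k + 1)"
    unfolding mem_symbolic_power_edge_ideal_iff[OF w]
  proof (intro allI impI)
    fix C assume C: "minimal_vertex_cover ED C"
    have "locally_in_power ED w C (sum b C) (\<Prod>v\<in>C. (Var v ^ w v :: ('v, 'k) mpoly) ^ b v)"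
      by (intro locally_in_power_prod locally_in_power_power Var_power_locally_in_power C loop w) auto
    then have "locally_in_power ED w C (sum b C)
        ((\<Prod>v\<in>C. (Var v ^ w v :: ('v, 'k) mpoly) ^ b v) * (\<Prod>v\<in>- C. (Var v ^ w v) ^ b v))"
      by (rule locally_in_power_multiple)
    also have "(\<Prod>v\<in>C. (Var v ^ w v :: ('v, 'k) mpoly) ^ b v) * (\<Prod>v\<in>- C. (Var v ^ w v) ^ b v) = ?f"
      by (subst prod.union_disjoint[symmetric]) (auto simp: power_mult)
    finally obtain h where "h \<notin> variables_prime C" "h * ?f \<in> ideal_power (edge_ideal ED w) (sum b C)"
      unfolding locally_in_power_def by blast
    moreover have "k + 1 \<le> sum b C" using covers C by (simp add: minimal_vertex_cover_def)
    ultimately show "\<exists>h. h \<notin> variables_prime C \<and> h * ?f \<in> ideal_power (edge_ideal ED w) (k + 1)"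
      using ideal_power_antimono[OF edge_ideal_is_ideal] by blast
  qed
qed

section \<open>Packing edges in a bipartite graph\<close>

lemma sum_eq_sum_UNIV: "sum b M = (\<Sum>v::'v::finite\<in>UNIV. if v \<in> M then b v else (0::nat))"
  by (simp add: sum.If_cases)

text \<open>
  Call a cover tight if it has the least weight \<open>sum b T\<close>. Every vertex \<open>u \<in> A\<close> of positive weight in a
  tight cover has a neighbour \<open>v\<close> of positive weight such that no tight cover contains both ends. Let
  \<open>S\<close> be the tight cover containing \<open>u\<close> that has the smallest part in \<open>A\<close> and the largest part outside
  \<open>A\<close>; it exists because tight covers form a lattice. If all neighbours of \<open>u\<close> outside \<open>S\<close> had weight 0,
  exchanging \<open>u\<close> for them would produce a lighter cover. A neighbour \<open>v \<notin> S\<close> of positive weight is as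
  desired, for a tight cover containing \<open>u\<close> and \<open>v\<close> could be combined with \<open>S\<close> to contradict the choice
  of \<open>S\<close>.
\<close>

lemma bipartite_reducing_edge_aux:
  fixes ED :: "('v::finite \<times> 'v) set" and b :: "'v \<Rightarrow> nat"
  assumes bip: "\<And>x y. (x, y) \<in> ED \<Longrightarrow> x \<in> A \<longleftrightarrow> y \<notin> A"
    and T: "vertex_cover ED T" and Tmin: "\<And>C. vertex_cover ED C \<Longrightarrow> sum b T \<le> sum b C"
    and u: "u \<in> T" "u \<in> A" "b u > 0"
  shows "\<exists>v. ((u, v) \<in> ED \<or> (v, u) \<in> ED) \<and> b v > 0 \<and>
    (\<forall>C. vertex_cover ED C \<longrightarrow> u \<in> C \<longrightarrow> v \<in> C \<longrightarrow> sum b T < sum b C)"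
proof -
  \<comment> \<open>Minimizing \<open>\<mu>\<close> selects the least element of the lattice.\<close>
  define \<mu> where "\<mu> C = card (C \<inter> A) + card (- A - C)" for C
  let ?tight = "\<lambda>C. vertex_cover ED C \<and> u \<in> C \<and> sum b C = sum b T"
  have "\<exists>S. ?tight S \<and> (\<forall>C. ?tight C \<longrightarrow> \<mu> S \<le> \<mu> C)"
    by (rule ex_has_least_nat[of ?tight T]) (use T u in auto)
  then obtain S where S: "vertex_cover ED S" "u \<in> S" "sum b S = sum b T"
    and Smin: "\<And>C. ?tight C \<Longrightarrow> \<mu> S \<le> \<mu> C"
    by blast
  define N where "N = {v. (u, v) \<in> ED \<or> (v, u) \<in> ED}"
  have NA: "v \<notin> A" if "v \<in> N" for v
    using that bip u by (auto simp: N_def)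
  have "\<exists>v\<in>N. v \<notin> S \<and> b v > 0"
  proof (rule ccontr)
    assume "\<not> ?thesis"
    then have zero: "sum b (N - S) = 0" by auto
    have "vertex_cover ED ((S - {u}) \<union> (N - S))"
      using S(1) NA u(2) by (auto simp: vertex_cover_def N_def)
    then have "sum b T \<le> sum b ((S - {u}) \<union> (N - S))" by (rule Tmin)
    also have "\<dots> = sum b (S - {u})"
      using zero by (subst sum.union_disjoint) auto
    also have "\<dots> < sum b S"
      using u S(2) by (simp add: sum.remove[of S u])
    finally show False using S(3) by simp
  qed
  then obtain v where v: "v \<in> N" "v \<notin> S" "b v > 0" by blast
  have "sum b T < sum b C" if C: "vertex_cover ED C" "u \<in> C" "v \<in> C" for C
  proof (rule ccontr)
    assume "\<not> sum b T < sum b C"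
    with Tmin[OF C(1)] have tightC: "sum b C = sum b T" by simp
    \<comment> \<open>Meet and join of \<open>C\<close> and \<open>S\<close>: the two are covers as the graph is bipartite,
        and together they weigh as much as \<open>C\<close> and \<open>S\<close>, so both are tight.\<close>
    define M where "M = (C \<inter> S \<inter> A) \<union> ((C \<union> S) - A)"
    define J where "J = ((C \<union> S) \<inter> A) \<union> (C \<inter> S - A)"
    have "x \<in> M \<or> y \<in> M" "x \<in> J \<or> y \<in> J" if "(x, y) \<in> ED" for x y
      using bip[OF that] that C(1) S(1) unfolding M_def J_def vertex_cover_def by blast+
    then have covers: "vertex_cover ED M" "vertex_cover ED J"
      by (auto simp: vertex_cover_def)
    have "sum b M + sum b J = sum b C + sum b S"
      unfolding sum_eq_sum_UNIV[of b] sum.distrib[symmetric]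
      by (rule sum.cong) (auto simp: M_def J_def)
    then have "sum b M = sum b T"
      using Tmin[OF covers(1)] Tmin[OF covers(2)] tightC S(3) by simp
    then have "\<mu> S \<le> \<mu> M"
      using covers(1) C(2) S(2) u(2) by (intro Smin) (auto simp: M_def)
    moreover have "card (M \<inter> A) \<le> card (S \<inter> A)"
      by (rule card_mono) (auto simp: M_def)
    moreover have "card (- A - M) < card (- A - S)"
      by (rule psubset_card_mono) (use v C(3) NA in \<open>auto simp: M_def\<close>)
    ultimately show False by (simp add: \<mu>_def)
  qed
  with v show ?thesis by (auto simp: N_def)
qed

text \<open>
  The step of an induction proving the theorem of Koenig with vertex capacities \<open>b\<close>: the edge
  \<open>{u, v}\<close> can be removed, lowering the capacity of both ends by 1, and the capacity of each cover stays
  at least \<open>n\<close>.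
\<close>

lemma bipartite_reducing_edge:
  fixes ED :: "('v::finite \<times> 'v) set" and b :: "'v \<Rightarrow> nat"
  assumes bip: "\<And>x y. (x, y) \<in> ED \<Longrightarrow> x \<in> A \<longleftrightarrow> y \<notin> A"
    and covers: "\<And>C. vertex_cover ED C \<Longrightarrow> Suc n \<le> sum b C"
  shows "\<exists>u v. ((u, v) \<in> ED \<or> (v, u) \<in> ED) \<and> b u > 0 \<and> b v > 0 \<and>
    (\<forall>C. vertex_cover ED C \<longrightarrow> n + of_bool (u \<in> C) + of_bool (v \<in> C) \<le> sum b C)"
proof -
  have "\<exists>T. vertex_cover ED T \<and> (\<forall>C. vertex_cover ED C \<longrightarrow> sum b T \<le> sum b C)"
    by (rule ex_has_least_nat[of "vertex_cover ED" UNIV]) (auto simp: vertex_cover_def)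
  then obtain T where T: "vertex_cover ED T" "\<And>C. vertex_cover ED C \<Longrightarrow> sum b T \<le> sum b C"
    by blast
  have "sum b T \<noteq> 0" using covers[OF T(1)] by linarith
  then obtain u where u: "u \<in> T" "b u > 0" by auto
  have "\<exists>v. ((u, v) \<in> ED \<or> (v, u) \<in> ED) \<and> b v > 0 \<and>
    (\<forall>C. vertex_cover ED C \<longrightarrow> u \<in> C \<longrightarrow> v \<in> C \<longrightarrow> sum b T < sum b C)"
  proof (cases "u \<in> A")
    case True
    show ?thesis
      by (rule bipartite_reducing_edge_aux[of ED A T b u]) (use bip T u True in auto)
  next
    case False
    show ?thesis
      by (rule bipartite_reducing_edge_aux[of ED "- A" T b u]) (use bip T u False in auto)
  qed
  then obtain v where v: "(u, v) \<in> ED \<or> (v, u) \<in> ED" "b v > 0"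
    "\<And>C. vertex_cover ED C \<Longrightarrow> u \<in> C \<Longrightarrow> v \<in> C \<Longrightarrow> sum b T < sum b C"
    by blast
  have "n + of_bool (u \<in> C) + of_bool (v \<in> C) \<le> sum b C" if C: "vertex_cover ED C" for C
    using covers[OF C] covers[OF T(1)] v(3)[OF C] by (cases "u \<in> C"; cases "v \<in> C") auto
  with u v show ?thesis by blast
qed

text \<open>
  With the capacities \<open>lookup a c div w c\<close>, an edge can be chosen whenever both of its ends have
  capacity at least 1, for its generator has the exponents \<open>1 = w x\<close> and \<open>w y\<close>; choosing it lowers just
  these two capacities, each by 1.
\<close>

lemma edge_multiple_if_covers:
  fixes ED :: "('v::finite \<times> 'v) set"
  assumes bip: "\<And>x y. (x, y) \<in> ED \<Longrightarrow> x \<in> A \<longleftrightarrow> y \<notin> A"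
    and w: "\<And>v. w v \<ge> 1" and tail: "\<And>x y. (x, y) \<in> ED \<Longrightarrow> w x = 1"
    and covers: "\<And>C. vertex_cover ED C \<Longrightarrow> n \<le> (\<Sum>c\<in>C. lookup a c div w c)"
  shows "edge_multiple ED w n a"
  using covers
proof (induction n arbitrary: a)
  case (Suc n)
  let ?b = "\<lambda>c. lookup a c div w c"
  obtain u v where uv: "(u, v) \<in> ED \<or> (v, u) \<in> ED" "?b u > 0" "?b v > 0"
    "\<And>C. vertex_cover ED C \<Longrightarrow> n + of_bool (u \<in> C) + of_bool (v \<in> C) \<le> sum ?b C"
    using bipartite_reducing_edge[of ED A n ?b, OF bip Suc.prems] by blast
  obtain x y where xy: "(x, y) \<in> ED" "?b x > 0" "?b y > 0"
    and red: "\<And>C. vertex_cover ED C \<Longrightarrow> n + of_bool (x \<in> C) + of_bool (y \<in> C) \<le> sum ?b C"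
  proof (cases "(u, v) \<in> ED")
    case True
    then show ?thesis using that[of u v] uv by blast
  next
    case False
    then show ?thesis using that[of v u] uv by (auto simp: ac_simps)
  qed
  have ne: "x \<noteq> y" using bip[OF xy(1)] by auto
  have wx: "w x = 1" using tail xy by blast
  have ge: "lookup a x \<ge> 1" "lookup a y \<ge> w y"
    using xy wx by (auto simp: div_greater_zero_iff)
  define a' where "a' = a - edge_exponent w x y"
  have a: "a = a' + edge_exponent w x y"
    using ge ne by (intro poly_mapping_eqI)
      (auto simp: a'_def edge_exponent_def lookup_add lookup_minus lookup_single when_def)
  have "lookup a' c div w c + (of_bool (c = x) + of_bool (c = y)) = ?b c" for c
    using ge ne wx w[of y] le_div_geq[of "w y" "lookup a y"]
    by (auto simp: a'_def edge_exponent_def lookup_add lookup_minus lookup_single when_def)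
  then have "sum ?b C = (\<Sum>c\<in>C. lookup a' c div w c + (of_bool (c = x) + of_bool (c = y)))" for C
    by simp
  then have "sum ?b C = (\<Sum>c\<in>C. lookup a' c div w c) + (of_bool (x \<in> C) + of_bool (y \<in> C))" for C
    by (simp add: sum.distrib of_bool_def sum.delta)
  then have "n \<le> (\<Sum>c\<in>C. lookup a' c div w c)" if "vertex_cover ED C" for C
    using red[OF that] by simp
  then have "edge_multiple ED w n a'" by (rule Suc.IH)
  with xy(1) a show ?case unfolding edge_multiple.simps by blast
qed auto

text \<open>
  A cover contains an end of each edge, and because tails have weight 1 the generator contributes a
  full \<open>w c\<close> to the exponent of either end \<open>c\<close>.
\<close>

lemma covers_if_edge_multiple:
  fixes ED :: "('v::finite \<times> 'v) set"
  assumes w: "\<And>v. w v \<ge> 1" and tail: "\<And>x y. (x, y) \<in> ED \<Longrightarrow> w x = 1"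
    and C: "vertex_cover ED C" and a: "edge_multiple ED w n a"
  shows "n \<le> (\<Sum>c\<in>C. lookup a c div w c)"
  using a
proof (induction n arbitrary: a)
  case (Suc n)
  then obtain x y b where b: "(x, y) \<in> ED" "a = b + edge_exponent w x y" "edge_multiple ED w n b"
    by auto
  let ?e = "edge_exponent w x y"
  have "lookup ?e x div w x \<ge> 1" "lookup ?e y div w y \<ge> 1"
    using tail[OF b(1)] w[of y]
    by (auto simp: edge_exponent_def lookup_add lookup_single when_def Suc_le_eq div_greater_zero_iff)
  moreover obtain c where "c \<in> C" "c = x \<or> c = y"
    using C b(1) by (auto simp: vertex_cover_def)
  ultimately have "1 \<le> lookup ?e c div w c" by auto
  also have "\<dots> \<le> (\<Sum>c\<in>C. lookup ?e c div w c)"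
    using \<open>c \<in> C\<close> by (intro member_le_sum) auto
  finally have "Suc n \<le> (\<Sum>c\<in>C. lookup b c div w c) + (\<Sum>c\<in>C. lookup ?e c div w c)"
    using Suc.IH[OF b(3)] by simp
  also have "\<dots> = (\<Sum>c\<in>C. lookup b c div w c + lookup ?e c div w c)"
    by (simp add: sum.distrib)
  also have "\<dots> \<le> (\<Sum>c\<in>C. lookup a c div w c)"
    unfolding b(2) lookup_add by (intro sum_mono) (metis div_add1_eq le_add1)
  finally show ?case .
qed auto

lemma ordinary_subset_symbolic_power:
  fixes ED :: "('v::{finite,linorder} \<times> 'v) set"
  assumes w: "\<And>v. w v \<ge> 1"
  shows "ideal_power (edge_ideal ED w :: ('v, 'k::field) mpoly set) n \<subseteq> symbolic_power (edge_ideal ED w) n"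
proof
  fix f :: "('v, 'k) mpoly" assume "f \<in> ideal_power (edge_ideal ED w) n"
  then show "f \<in> symbolic_power (edge_ideal ED w) n"
    unfolding mem_symbolic_power_edge_ideal_iff[OF w]
    using one_notin_variables_prime by (metis mult_1)
qed

text \<open>
  The bound on the capacity of a minimal cover survives localization at it, since it depends only on
  the exponents of the variables in the cover; other covers contain a minimal one.
\<close>

lemma symbolic_subset_ordinary_power:
  fixes ED :: "('v::{finite,linorder} \<times> 'v) set"
  assumes w: "\<And>v. w v \<ge> 1" and tail: "\<And>x y. (x, y) \<in> ED \<Longrightarrow> w x = 1"
    and bip: "\<And>x y. (x, y) \<in> ED \<Longrightarrow> x \<in> A \<longleftrightarrow> y \<notin> A"
  shows "symbolic_power (edge_ideal ED w :: ('v, 'k::field) mpoly set) n \<subseteq> ideal_power (edge_ideal ED w) n"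
proof
  fix f :: "('v, 'k) mpoly" assume f: "f \<in> symbolic_power (edge_ideal ED w) n"
  have minimal: "n \<le> (\<Sum>c\<in>C. lookup a c div w c)"
    if a: "a \<in> keys f" and C: "minimal_vertex_cover ED C" for a C
  proof -
    obtain h where h: "h \<notin> variables_prime C" "h * f \<in> ideal_power (edge_ideal ED w) n"
      using f C unfolding mem_symbolic_power_edge_ideal_iff[OF w] by blast
    obtain m where m: "m \<in> keys h" "\<forall>c\<in>C. lookup m c = 0"
      using h(1) by (auto simp: variables_prime_def)
    have "\<forall>a\<in>keys f. n \<le> (\<Sum>c\<in>C. lookup a c div w c)"
    proof (rule keys_saturated[where P = "\<lambda>a. n \<le> (\<Sum>c\<in>C. lookup a c div w c)", OF _ _ m])
      show "n \<le> (\<Sum>c\<in>C. lookup (a + b) c div w c)"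
        if "n \<le> (\<Sum>c\<in>C. lookup a c div w c)" for a b
        by (rule order.trans[OF that], rule sum_mono) (simp add: lookup_add div_le_mono)
      show "n \<le> (\<Sum>c\<in>C. lookup a c div w c)"
        if "n \<le> (\<Sum>c\<in>C. lookup (m + a) c div w c)" "\<forall>c\<in>C. lookup m c = 0" for a m
        using that by (simp add: lookup_add)
      show "\<forall>a\<in>keys (h * f). n \<le> (\<Sum>c\<in>C. lookup a c div w c)"
      proof
        fix a assume "a \<in> keys (h * f)"
        then have "edge_multiple ED w n a" using h(2) unfolding mem_edge_ideal_power_iff by blast
        moreover have "vertex_cover ED C" using C by (simp add: minimal_vertex_cover_def)
        ultimately show "n \<le> (\<Sum>c\<in>C. lookup a c div w c)"
          by (intro covers_if_edge_multiple[of w ED C n a, OF w]) (rule tail)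
      qed
    qed
    with a show ?thesis by blast
  qed
  have "edge_multiple ED w n a" if a: "a \<in> keys f" for a
  proof (rule edge_multiple_if_covers[where ED = ED and A = A])
    show "x \<in> A \<longleftrightarrow> y \<notin> A" if "(x, y) \<in> ED" for x y by (rule bip[OF that])
    show "w x = 1" if "(x, y) \<in> ED" for x y by (rule tail[OF that])
    show "w v \<ge> 1" for v by (rule w)
    fix C assume "vertex_cover ED C"
    then obtain C' where C': "C' \<subseteq> C" "minimal_vertex_cover ED C'"
      using vertex_cover_contains_minimal[OF finite] by blast
    show "n \<le> (\<Sum>c\<in>C. lookup a c div w c)"
      by (rule order.trans[OF minimal[OF a C'(2)]], rule sum_mono2) (use C' in auto)
  qed
  then show "f \<in> ideal_power (edge_ideal ED w) n"
    unfolding mem_edge_ideal_power_iff by blast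
qed

section \<open>Comparison of the powers\<close>

lemma bipartite_iff_colouring:
  fixes EG :: "'v::finite set set"
  assumes "weighted_oriented_graph EG ED w"
  shows "bipartite EG \<longleftrightarrow> (\<exists>A. \<forall>(x, y)\<in>ED. x \<in> A \<longleftrightarrow> y \<notin> A)"
proof -
  have EG: "EG = {{x, y} |x y. (x, y) \<in> ED}"
    by (rule weighted_oriented_graph.underlying[OF assms])
  show ?thesis
  proof
    assume "bipartite EG"
    then obtain A B where AB: "A \<union> B = UNIV" "A \<inter> B = {}"
      "\<And>e. e \<in> EG \<Longrightarrow> \<exists>x\<in>A. \<exists>y\<in>B. e = {x, y}"
      unfolding bipartite_def by auto
    have "x \<in> A \<longleftrightarrow> y \<notin> A" if "(x, y) \<in> ED" for x y
    proof -
      have "{x, y} \<in> EG" using that EG by blast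
      then obtain s t where "s \<in> A" "t \<in> B" "{x, y} = {s, t}" using AB(3) by blast
      moreover have "t \<notin> A" using \<open>t \<in> B\<close> AB(2) by blast
      ultimately show ?thesis unfolding doubleton_eq_iff by (elim disjE conjE) simp_all
    qed
    then have "\<forall>(x, y)\<in>ED. x \<in> A \<longleftrightarrow> y \<notin> A"
      by (intro ballI, rule case_prodI2) simp
    then show "\<exists>A. \<forall>(x, y)\<in>ED. x \<in> A \<longleftrightarrow> y \<notin> A" ..
  next
    assume "\<exists>A. \<forall>(x, y)\<in>ED. x \<in> A \<longleftrightarrow> y \<notin> A"
    then obtain A where col: "\<forall>(x, y)\<in>ED. x \<in> A \<longleftrightarrow> y \<notin> A" ..
    have A: "x \<in> A \<longleftrightarrow> y \<notin> A" if "(x, y) \<in> ED" for x y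
      using bspec[OF col that] by simp
    have "\<exists>x\<in>A. \<exists>y\<in>- A. e = {x, y}" if e: "e \<in> EG" for e
    proof -
      obtain x y where xy: "(x, y) \<in> ED" "e = {x, y}" using e unfolding EG by blast
      show ?thesis
      proof (cases "x \<in> A")
        case True
        with A[OF xy(1)] have "y \<in> - A" by simp
        with True xy(2) show ?thesis by blast
      next
        case False
        with A[OF xy(1)] have "y \<in> A" "x \<in> - A" "e = {y, x}" using xy(2) by auto
        then show ?thesis by blast
      qed
    qed
    then show "bipartite EG"
      unfolding bipartite_def by (intro exI[of _ A] exI[of _ "- A"] conjI ballI) simp_all
  qed
qed

text \<open>
  Sending a directed edge to its underlying edge is onto, hence injective as both sets are finite and
  have the same size.
\<close>

lemma weighted_oriented_graph_asym:
  fixes EG :: "'v::finite set set"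
  assumes D: "weighted_oriented_graph EG ED w" and xy: "(x, y) \<in> ED"
  shows "(y, x) \<notin> ED"
proof
  assume yx: "(y, x) \<in> ED"
  have EG: "EG = (\<lambda>(x, y). {x, y}) ` ED"
    unfolding weighted_oriented_graph.underlying[OF D] by auto
  have "card EG = card ED"
    by (rule weighted_oriented_graph.one_direction[OF D, symmetric])
  then have "inj_on (\<lambda>(x, y). {x, y}) ED"
    unfolding EG by (intro eq_card_imp_inj_on finite)
  then have "(x, y) = (y, x)"
    by (rule inj_onD) (use xy yx in auto)
  then have "x = y" unfolding prod.inject by (rule conjunct1)
  have edge: "{x, y} \<in> EG" unfolding EG by (rule image_eqI[OF _ xy]) simp
  have "\<forall>e\<in>EG. card e = 2"
    using weighted_oriented_graph.simple[OF D] unfolding simple_graph_def .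
  from bspec[OF this edge] have "card {x, y} = 2" .
  with \<open>x = y\<close> show False by simp
qed

theorem theorem3p3:
  fixes EG :: "'v::{finite,linorder} set set"
    and ED :: "('v \<times> 'v) set"
    and w :: "'v \<Rightarrow> nat"
    and I :: "('v, 'k::field) mpoly set"
  assumes "weighted_oriented_graph EG ED w"
    and "\<And>v. is_source ED v \<Longrightarrow> w v = 1"
    and "I = edge_ideal ED w"
  shows "(\<forall>n\<ge>1. ideal_power I n = symbolic_power I n) \<longleftrightarrow>
         (\<forall>v\<in>V_plus w. is_sink ED v) \<and> bipartite EG"
proof -
  have w: "w v \<ge> 1" for v
    by (rule weighted_oriented_graph.weight_pos[OF assms(1)])
  note asym = weighted_oriented_graph_asym[OF assms(1)]
  have loop: "(v, v) \<notin> ED" for v using asym[of v v] by auto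
  have tail: "w x = 1" if "\<forall>v\<in>V_plus w. is_sink ED v" "(x, y) \<in> ED" for x y
  proof (rule ccontr)
    assume "w x \<noteq> 1"
    then have "x \<in> V_plus w" using w[of x] by (simp add: V_plus_def)
    with that(1) have "is_sink ED x" by blast
    with that(2) show False by (simp add: is_sink_def)
  qed
  show ?thesis
  proof
    assume eq: "\<forall>n\<ge>1. ideal_power I n = symbolic_power I n"
    have sink: "is_sink ED y" if "y \<in> V_plus w" for y
    proof (rule ccontr)
      assume "\<not> is_sink ED y"
      then obtain z where yz: "(y, z) \<in> ED" by (auto simp: is_sink_def)
      have wy: "w y \<ge> 2" using that by (simp add: V_plus_def)
      then have "\<not> is_source ED y" using assms(2)[of y] by auto
      then obtain x where xy: "(x, y) \<in> ED" by (auto simp: is_source_def)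
      have "(Var x * Var y ^ w y * Var z ^ w z :: ('v, 'k) mpoly) \<in> ideal_power I 2"
        using path_in_symbolic_square[of ED w x y z, OF loop w xy yz wy] eq assms(3) by simp
      moreover have "(Var x * Var y ^ w y * Var z ^ w z :: ('v, 'k) mpoly) =
          single (single x 1 + single y (w y) + single z (w z)) 1"
        unfolding Var_power by (simp add: Var_def mult_single)
      ultimately have "edge_multiple ED w 2 (single x 1 + single y (w y) + single z (w z))"
        unfolding assms(3) mem_edge_ideal_power_iff by simp
      with path_not_edge_multiple[of ED w x y z, OF asym w xy yz wy] show False by blast
    qed
    have "bipartite EG"
    proof (rule ccontr)
      assume "\<not> bipartite EG"
      then have "\<nexists>A. \<forall>(x, y)\<in>ED. x \<in> A \<longleftrightarrow> y \<notin> A"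
        using bipartite_iff_colouring[OF assms(1)] by simp
      from odd_closed_walk_weights[OF this] obtain b :: "'v \<Rightarrow> nat" and k where
        b: "sum b UNIV = 2 * k + 1" "\<And>C. vertex_cover ED C \<Longrightarrow> k + 1 \<le> sum b C"
        by blast
      have "(\<Prod>v\<in>UNIV. Var v ^ (w v * b v)) \<in> symbolic_power I (k + 1) - ideal_power I (k + 1)"
        unfolding assms(3)
      proof (rule symbolic_not_ordinary_if_odd_weights)
        show "w x = 1" if "(x, y) \<in> ED" for x y using tail sink that by blast
      qed (use loop w b in auto)
      with eq show False by simp
    qed
    with sink show "(\<forall>v\<in>V_plus w. is_sink ED v) \<and> bipartite EG" by blast
  next
    assume R: "(\<forall>v\<in>V_plus w. is_sink ED v) \<and> bipartite EG"
    then obtain A where A: "\<forall>(x, y)\<in>ED. x \<in> A \<longleftrightarrow> y \<notin> A"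
      using bipartite_iff_colouring[OF assms(1)] by blast
    have "symbolic_power I n \<subseteq> ideal_power I n" for n
      unfolding assms(3)
    proof (rule symbolic_subset_ordinary_power)
      show "x \<in> A \<longleftrightarrow> y \<notin> A" if "(x, y) \<in> ED" for x y using A that by auto
      show "w x = 1" if "(x, y) \<in> ED" for x y using tail R that by blast
    qed (rule w)
    moreover have "ideal_power I n \<subseteq> symbolic_power I n" for n
      unfolding assms(3) by (rule ordinary_subset_symbolic_power) (rule w)
    ultimately show "\<forall>n\<ge>1. ideal_power I n = symbolic_power I n"
      by (intro allI impI subset_antisym)
  qed
qed

end
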